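(* Let $D$ be the degree sequence of a tree and let $\mathbb{T}_D$ be the set of all trees with degree sequence $D$. A tree $T\in\mathbb{T}_D$ satisfies $\mathrm{SO}(T)=\min\{\mathrm{SO}(T''):T''\in\mathbb{T}_D\}$ if and only if $T$ is isomorphic to a tree obtained from the greedy tree $G(D)$ by a finite (possibly empty) sequence of exchanges of branches between vertices of the same degree.
   Context: For a graph $G$, $\mathrm{SO}(G)=\sum_{uv\in E(G)}\sqrt{\deg_G(u)^2+\deg_G(v)^2}$. Greedy tree: write $D=(d_1\ge d_2\ge\dots\ge d_n)$. $G(D)$ has vertices $w_1,\dots,w_n$ with $\deg w_i=d_i$, constructed breadth-first: $w_1$ is the root and its neighbours are $w_2,\dots,w_{d_1+1}$; then, for $i=2,3,\dots$ in order, the children of $w_i$ are the next $d_i-1$ vertices not yet used (in order of index). Exchange of branches between vertices of the same degree: given a tree $T$ rooted at some vertex, choose distinct vertices $x,y$ with $\deg x=\deg y$, a child $a$ of $x$ and a child $b$ of $y$ such that $T-xa-yb+xb+ya$ is a tree, and replace $T$ by this tree (children of $x$ are its neighbours farther from the root). *)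

theory Defs
  imports Complex_Main "HOL-Library.Multiset"
begin

text \<open>
  Finite simple graphs are given by a vertex set and a set of two-element edges. The AFP entry
  Graph_Theory encodes an undirected edge by two opposite arcs, and these already form a cycle
  there, so its notion of tree does not cover undirected trees.
\<close>

record 'a sgraph =
  verts :: "'a set"
  edges :: "'a set set"

definition simple_graph :: "'a sgraph \<Rightarrow> bool" where
  "simple_graph G \<longleftrightarrow> finite (verts G) \<and> (\<forall>e\<in>edges G. e \<subseteq> verts G \<and> card e = 2)"

definition walk :: "'a sgraph \<Rightarrow> 'a list \<Rightarrow> bool" where
  "walk G p \<longleftrightarrow> p \<noteq> [] \<and> set p \<subseteq> verts G \<and> successively (\<lambda>u v. {u, v} \<in> edges G) p"

definition connected_graph :: "'a sgraph \<Rightarrow> bool" where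
  "connected_graph G \<longleftrightarrow> verts G \<noteq> {} \<and>
     (\<forall>u\<in>verts G. \<forall>v\<in>verts G. \<exists>p. walk G p \<and> hd p = u \<and> last p = v)"

definition cycle :: "'a sgraph \<Rightarrow> 'a list \<Rightarrow> bool" where
  "cycle G p \<longleftrightarrow> walk G p \<and> distinct p \<and> length p \<ge> 3 \<and> {last p, hd p} \<in> edges G"

definition tree :: "'a sgraph \<Rightarrow> bool" where
  "tree T \<longleftrightarrow> simple_graph T \<and> connected_graph T \<and> (\<nexists>p. cycle T p)"

definition degree :: "'a sgraph \<Rightarrow> 'a \<Rightarrow> nat" where
  "degree G v = card {e \<in> edges G. v \<in> e}"

text \<open>The degrees of all vertices, with multiplicity, in non-increasing order.\<close>

definition degree_sequence :: "'a sgraph \<Rightarrow> nat list" where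
  "degree_sequence G =
     rev (sorted_list_of_multiset (image_mset (degree G) (mset_set (verts G))))"

definition trees_with_degree_sequence :: "nat list \<Rightarrow> 'a sgraph set" where
  "trees_with_degree_sequence D = {T. tree T \<and> degree_sequence T = D}"

text \<open>For an edge \<open>e = {u, v}\<close> the inner sum is \<open>deg(u)\<^sup>2 + deg(v)\<^sup>2\<close>.\<close>

definition SO :: "'a sgraph \<Rightarrow> real" where
  "SO G = (\<Sum>e\<in>edges G. sqrt (\<Sum>v\<in>e. (real (degree G v))\<^sup>2))"

text \<open>The minimum of \<open>SO\<close> over all trees with degree sequence \<open>D\<close> is taken over a finite set.\<close>

lemma finite_SO_trees: "finite (SO ` (trees_with_degree_sequence D :: 'a sgraph set))"
proof -
  define N :: nat where "N = 2 ^ length D"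
  define L where "L = {ks :: nat list. set ks \<subseteq> {..2 * N\<^sup>2} \<and> length ks \<le> N}"
  have "finite L"
    unfolding L_def by (rule finite_lists_length_le) simp
  moreover have "SO ` (trees_with_degree_sequence D :: 'a sgraph set)
      \<subseteq> (\<lambda>ks. sum_list (map (\<lambda>k. sqrt (real k)) ks)) ` L"
  proof (rule image_subsetI)
    fix T :: "'a sgraph"
    assume T: "T \<in> trees_with_degree_sequence D"
    then have sg: "simple_graph T" and D: "degree_sequence T = D"
      by (auto simp: trees_with_degree_sequence_def tree_def)
    have fin: "finite (verts T)" and sub: "edges T \<subseteq> Pow (verts T)"
      and two: "\<And>e. e \<in> edges T \<Longrightarrow> card e = 2"
      using sg by (auto simp: simple_graph_def)
    have len: "length D = card (verts T)"
      unfolding D[symmetric] degree_sequence_def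
      by (metis length_rev mset_sorted_list_of_multiset size_image_mset size_mset size_mset_set)
    have finE: "finite (edges T)"
      using finite_subset[OF sub] fin by simp
    have cE: "card (edges T) \<le> N"
      using card_mono[OF _ sub] fin by (simp add: N_def len card_Pow)
    have deg: "degree T v \<le> N" for v
      unfolding degree_def by (rule order_trans[OF card_mono[OF finE] cE]) auto
    obtain es where es: "set es = edges T" "distinct es"
      using finite_distinct_list[OF finE] by blast
    define g where "g = (\<lambda>e. \<Sum>v\<in>e. (degree T v)\<^sup>2)"
    have "g e \<le> 2 * N\<^sup>2" if "e \<in> edges T" for e
      using sum_bounded_above[of e "\<lambda>v. (degree T v)\<^sup>2" "N\<^sup>2"] two[OF that] deg
      by (simp add: g_def power_mono)
    then have "map g es \<in> L"
      using es cE by (auto simp: L_def distinct_card[symmetric])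
    moreover have "SO T = sum_list (map (\<lambda>k. sqrt (real k)) (map g es))"
      using es(2)
      by (simp add: SO_def g_def es(1)[symmetric] sum_list_distinct_conv_sum_set comp_def)
    ultimately show "SO T \<in> (\<lambda>ks. sum_list (map (\<lambda>k. sqrt (real k)) ks)) ` L"
      by blast
  qed
  ultimately show ?thesis
    by (metis finite_imageI finite_subset)
qed

definition isomorphic :: "'a sgraph \<Rightarrow> 'b sgraph \<Rightarrow> bool" where
  "isomorphic G H \<longleftrightarrow> (\<exists>f. bij_betw f (verts G) (verts H) \<and>
     (\<forall>u\<in>verts G. \<forall>v\<in>verts G. {u, v} \<in> edges G \<longleftrightarrow> {f u, f v} \<in> edges H))"

text \<open>
  The greedy tree on the vertices \<open>1, \<dots>, n\<close>, where \<open>D = [d\<^sub>1, \<dots>, d\<^sub>n]\<close>, so that \<open>d\<^sub>i\<close> is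
  \<open>D ! (i - 1)\<close>. After the children of \<open>1, \<dots>, i\<close> have been assigned, the vertices used so far
  are \<open>1, \<dots>, greedy_used D i\<close>.
\<close>

definition greedy_children :: "nat list \<Rightarrow> nat \<Rightarrow> nat" where
  "greedy_children D i = (if i = 1 then D ! 0 else D ! (i - 1) - 1)"

primrec greedy_used :: "nat list \<Rightarrow> nat \<Rightarrow> nat" where
  "greedy_used D 0 = 1"
| "greedy_used D (Suc i) = greedy_used D i + greedy_children D (Suc i)"

definition greedy_tree :: "nat list \<Rightarrow> nat sgraph" where
  "greedy_tree D =
     \<lparr>verts = {1..length D},
      edges = {{i, j} | i j. i \<in> {1..length D} \<and> j \<in> {greedy_used D (i - 1)<..greedy_used D i}}\<rparr>"

definition distance :: "'a sgraph \<Rightarrow> 'a \<Rightarrow> 'a \<Rightarrow> nat" where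
  "distance G u v = (LEAST k. \<exists>p. walk G p \<and> hd p = u \<and> last p = v \<and> length p = Suc k)"

definition child :: "'a sgraph \<Rightarrow> 'a \<Rightarrow> 'a \<Rightarrow> 'a \<Rightarrow> bool" where
  "child T r x a \<longleftrightarrow> {x, a} \<in> edges T \<and> distance T r x < distance T r a"

text \<open>The root may be chosen anew for each exchange.\<close>

definition branch_exchange :: "'a sgraph \<Rightarrow> 'a sgraph \<Rightarrow> bool" where
  "branch_exchange T T' \<longleftrightarrow> tree T \<and>
     (\<exists>r\<in>verts T. \<exists>x\<in>verts T. \<exists>y\<in>verts T. \<exists>a b.
        x \<noteq> y \<and> degree T x = degree T y \<and> child T r x a \<and> child T r y b \<and>
        T' = \<lparr>verts = verts T,
              edges = (edges T - {{x, a}, {y, b}}) \<union> {{x, b}, {y, a}}\<rparr> \<and>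
        tree T')"

end

theory Submission
  imports Defs
begin

text \<open>
  For \<open>B < A\<close> and \<open>p < q\<close> strict concavity of the square root gives
  \<open>sqrt (A + q) + sqrt (B + p) < sqrt (A + p) + sqrt (B + q)\<close>. So if a path starts with the edge
  \<open>a - x\<close> and ends with the edge \<open>y - b\<close>, where \<open>x \<noteq> y\<close>, then a tree of minimal \<open>SO\<close> cannot have
  both \<open>deg x > deg y\<close> and \<open>deg a < deg b\<close>: exchanging \<open>a\<close> and \<open>b\<close> would improve it. Number the
  vertices by non-increasing degree, and suppose that the first \<open>k\<close> of them have the children
  prescribed by the greedy construction. If \<open>x\<close> is the next vertex and a child \<open>u\<close> of \<open>x\<close> has smaller
  degree than a prescribed child \<open>v\<close>, then \<open>v\<close> does not lie beyond \<open>u\<close>, and the minimality condition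
  forces the parent of \<open>v\<close> to have the degree of \<open>x\<close>. Exchanging \<open>u\<close> and \<open>v\<close> is thus an exchange of
  branches between vertices of the same degree, and repeating this turns every minimal tree into the
  greedy tree. Such exchanges are reversible and keep \<open>SO\<close>.
\<close>

section \<open>Forests and reachability\<close>

definition reach :: "'a set set \<Rightarrow> 'a \<Rightarrow> 'a \<Rightarrow> bool" where
  "reach E = (\<lambda>u v. {u, v} \<in> E)\<^sup>*\<^sup>*"

text \<open>Acyclicity is encoded as every edge being a bridge, which is easier to follow through
  deletions and insertions of edges than closed walks are.\<close>

definition forest :: "'a set set \<Rightarrow> bool" where
  "forest E \<longleftrightarrow> (\<forall>u v. {u, v} \<in> E \<longrightarrow> \<not> reach (E - {{u, v}}) u v)"

lemma reach_refl [simp]: "reach E u u"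
  by (simp add: reach_def)

lemma reach_edge: "{u, v} \<in> E \<Longrightarrow> reach E u v"
  by (simp add: reach_def r_into_rtranclp)

lemma reach_trans: "reach E u v \<Longrightarrow> reach E v w \<Longrightarrow> reach E u w"
  unfolding reach_def by (rule rtranclp_trans)

lemma reach_sym: "reach E u v \<Longrightarrow> reach E v u"
proof -
  have "symp (\<lambda>u v. {u, v} \<in> E)" by (rule sympI) (simp add: insert_commute)
  then show "reach E u v \<Longrightarrow> reach E v u"
    unfolding reach_def by (rule sympD[OF symp_rtranclp])
qed

lemma reach_mono: "reach E u v \<Longrightarrow> E \<subseteq> F \<Longrightarrow> reach F u v"
  unfolding reach_def by (erule mono_rtranclp[rule_format, rotated]) blast

lemma reach_induct [consumes 1, case_names base step]:
  assumes "reach E u v" "P u" "\<And>y z. reach E u y \<Longrightarrow> {y, z} \<in> E \<Longrightarrow> P y \<Longrightarrow> P z"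
  shows "P v"
  using assms unfolding reach_def by (rule rtranclp_induct)

text \<open>A second crossing of the new edge undoes the first, so one crossing suffices; the three
  alternatives serve as the induction invariant.\<close>

lemma reach_insert:
  assumes "reach (insert {u, v} F) s t"
  shows "reach F s t \<or> reach F s u \<and> reach F v t \<or> reach F s v \<and> reach F u t"
  using assms
proof (induction rule: reach_induct)
  case base
  then show ?case by simp
next
  case (step y z)
  show ?case
  proof (cases "{y, z} \<in> F")
    case True
    then have "reach F y z" by (rule reach_edge)
    with step.IH show ?thesis by (meson reach_trans)
  next
    case False
    with step.hyps have "y = u \<and> z = v \<or> y = v \<and> z = u"
      by (auto simp: doubleton_eq_iff)
    with step.IH show ?thesis
      by (meson reach_trans reach_sym reach_refl)
  qed
qed

lemma reach_remove:
  assumes "reach E s t"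
  shows "reach (E - {{u, v}}) s t \<or> reach (E - {{u, v}}) s u \<and> reach (E - {{u, v}}) v t
     \<or> reach (E - {{u, v}}) s v \<and> reach (E - {{u, v}}) u t"
  by (rule reach_insert) (rule reach_mono[OF assms], auto)

lemma forest_mono: "forest E \<Longrightarrow> F \<subseteq> E \<Longrightarrow> forest F"
  unfolding forest_def
proof (intro allI impI)
  fix u v
  assume E: "\<forall>u v. {u, v} \<in> E \<longrightarrow> \<not> reach (E - {{u, v}}) u v" "F \<subseteq> E" "{u, v} \<in> F"
  then have "\<not> reach (E - {{u, v}}) u v" by blast
  moreover have "F - {{u, v}} \<subseteq> E - {{u, v}}" using E(2) by blast
  ultimately show "\<not> reach (F - {{u, v}}) u v" using reach_mono[of "F - {{u, v}}" u v] by blast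
qed

lemma forest_bridge: "forest E \<Longrightarrow> {u, v} \<in> E \<Longrightarrow> \<not> reach (E - {{u, v}}) u v"
  by (simp add: forest_def)

text \<open>If an old edge \<open>{s, t}\<close> stopped being a bridge, its detour would cross the
  new edge and, together with \<open>{s, t}\<close>, join \<open>u\<close> to \<open>v\<close>
  inside \<open>F\<close>.\<close>

lemma forest_insert:
  assumes F: "forest F" and uv: "\<not> reach F u v"
  shows "forest (insert {u, v} F)"
  unfolding forest_def
proof (intro allI impI)
  fix s t
  assume st: "{s, t} \<in> insert {u, v} F"
  show "\<not> reach (insert {u, v} F - {{s, t}}) s t"
  proof (cases "{s, t} = {u, v}")
    case True
    then have "insert {u, v} F - {{s, t}} \<subseteq> F" by auto
    moreover have "\<not> reach F s t"
      using True uv by (metis doubleton_eq_iff reach_sym)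
    ultimately show ?thesis using reach_mono[of "insert {u, v} F - {{s, t}}" s t F] by blast
  next
    case False
    then have stF: "{s, t} \<in> F" using st by auto
    let ?G = "F - {{s, t}}"
    show ?thesis
    proof
      assume "reach (insert {u, v} F - {{s, t}}) s t"
      then have "reach (insert {u, v} ?G) s t"
        by (rule reach_mono) auto
      then have "reach ?G s t \<or> reach ?G s u \<and> reach ?G v t \<or> reach ?G s v \<and> reach ?G u t"
        by (rule reach_insert)
      moreover have "\<not> reach ?G s t" using F stF by (rule forest_bridge)
      moreover have "reach F p q" if "reach ?G p q" for p q
        using that by (rule reach_mono) auto
      ultimately show False
        using uv reach_edge[OF stF] by (meson reach_sym reach_trans)
    qed
  qed
qed

lemma reach_last_edge:
  assumes "reach E u v" "u \<noteq> v"
  shows "\<exists>p. {p, v} \<in> E \<and> reach (E - {{p, v}}) u p"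
proof -
  \<comment> \<open>Steps avoiding \<open>v\<close> describe the walk before its first arrival at
    \<open>v\<close>; they avoid the final edge whichever \<open>p\<close> it turns out to start
    from.\<close>
  define R where "R = (\<lambda>s t. {s, t} \<in> E \<and> s \<noteq> v \<and> t \<noteq> v)"
  have "u = v \<or> (\<exists>p. {p, v} \<in> E \<and> R\<^sup>*\<^sup>* u p)"
    using assms(1) unfolding reach_def
  proof (induction rule: converse_rtranclp_induct)
    case base
    then show ?case by simp
  next
    case (step u y)
    then show ?case
      by (cases "y = v") (auto simp: R_def intro: converse_rtranclp_into_rtranclp)
  qed
  then obtain p where p: "{p, v} \<in> E" "R\<^sup>*\<^sup>* u p"
    using assms(2) by blast
  have "R s t \<longrightarrow> {s, t} \<in> E - {{p, v}}" for s t
    by (auto simp: R_def doubleton_eq_iff)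
  then have "reach (E - {{p, v}}) u p"
    using p(2) mono_rtranclp[of R "\<lambda>s t. {s, t} \<in> E - {{p, v}}" u p]
    unfolding reach_def by blast
  with p(1) show ?thesis by blast
qed

section \<open>Distinct walks, cycles and trees\<close>

lemma reach_distinct_walk:
  assumes "R\<^sup>*\<^sup>* u v"
  shows "\<exists>p. p \<noteq> [] \<and> hd p = u \<and> last p = v \<and> distinct p \<and> successively R p"
  using assms
proof (induction rule: converse_rtranclp_induct)
  case base
  show ?case by (rule exI[of _ "[v]"]) simp
next
  case (step u w)
  then obtain p where p: "p \<noteq> []" "hd p = w" "last p = v" "distinct p" "successively R p"
    by blast
  show ?case
  proof (cases "u \<in> set p")
    case True
    then obtain ys zs where "p = ys @ u # zs" by (meson split_list)
    with p show ?thesis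
      by (intro exI[of _ "u # zs"]) (auto simp: successively_append_iff)
  next
    case False
    with p step.hyps show ?thesis
      by (intro exI[of _ "u # p"]) (auto simp: successively_Cons)
  qed
qed

lemma walk_reach:
  "p \<noteq> [] \<Longrightarrow> successively (\<lambda>u v. {u, v} \<in> E) p \<Longrightarrow> reach E (hd p) (last p)"
proof (induction p rule: induct_list012)
  case (3 x y zs)
  then show ?case by (auto intro: reach_trans reach_edge)
qed auto

lemma reach_walk:
  assumes "simple_graph G" "reach (edges G) u v" "u \<in> verts G"
  shows "\<exists>p. walk G p \<and> hd p = u \<and> last p = v \<and> distinct p"
proof -
  obtain p where p: "p \<noteq> []" "hd p = u" "last p = v" "distinct p"
      "successively (\<lambda>u v. {u, v} \<in> edges G) p"
    using reach_distinct_walk[OF assms(2)[unfolded reach_def]] by blast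
  have "set p \<subseteq> verts G"
    using p(1,2,5) assms(3)
  proof (induction p arbitrary: u)
    case (Cons a p)
    show ?case
    proof (cases p)
      case (Cons b q)
      then have "b \<in> verts G"
        using Cons.prems assms(1) by (auto simp: simple_graph_def)
      then show ?thesis using Cons.IH[of b] Cons.prems Cons by simp
    qed (use Cons.prems in simp)
  qed simp
  with p show ?thesis by (auto simp: walk_def)
qed

text \<open>A detour around an edge that is no bridge closes with it to a cycle; conversely the rest
  of a cycle is a detour around its closing edge.\<close>

lemma no_cycle_iff_forest:
  assumes "simple_graph G"
  shows "(\<nexists>p. cycle G p) \<longleftrightarrow> forest (edges G)"
proof
  assume nc: "\<nexists>p. cycle G p"
  show "forest (edges G)"
    unfolding forest_def
  proof (intro allI impI notI)
    fix u v
    assume uv: "{u, v} \<in> edges G" and r: "reach (edges G - {{u, v}}) u v"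
    let ?H = "\<lparr>verts = verts G, edges = edges G - {{u, v}}\<rparr>"
    have uV: "u \<in> verts G" and ne: "u \<noteq> v"
      using uv assms by (auto simp: simple_graph_def)
    have "simple_graph ?H"
      using assms by (auto simp: simple_graph_def)
    then obtain p where p: "walk ?H p" "hd p = u" "last p = v" "distinct p"
      using reach_walk[of ?H u v] r uV by auto
    have "length p \<ge> 3"
    proof (rule ccontr)
      assume "\<not> 3 \<le> length p"
      then have "length p = 0 \<or> length p = 1 \<or> length p = 2" by linarith
      then consider "p = []" | a where "p = [a]" | a b where "p = [a, b]"
        by (auto simp: length_Suc_conv numeral_2_eq_2)
      then show False
        using p ne by cases (auto simp: walk_def)
    qed
    moreover have "walk G p"
      using p(1) by (auto simp: walk_def intro: successively_mono)
    ultimately have "cycle G p"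
      using p uv by (simp add: cycle_def insert_commute)
    with nc show False by blast
  qed
next
  assume F: "forest (edges G)"
  show "\<nexists>p. cycle G p"
  proof
    assume "\<exists>p. cycle G p"
    then obtain p where p: "walk G p" "distinct p" "length p \<ge> 3" "{last p, hd p} \<in> edges G"
      by (auto simp: cycle_def)
    let ?e = "{hd p, last p}"
    have ne: "p \<noteq> []" using p(3) by auto
    have "successively (\<lambda>u v. {u, v} \<in> edges G - {?e}) p"
      unfolding successively_conv_nth
    proof (intro allI impI)
      fix i
      assume i: "Suc i < length p"
      have "{p ! i, p ! Suc i} \<in> edges G"
        using p(1) i by (auto simp: walk_def successively_conv_nth)
      \<comment> \<open>By distinctness a consecutive pair could be the closing pair only in a walk
        of two vertices.\<close>
      moreover have "{p ! i, p ! Suc i} \<noteq> ?e"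
        using i p(2,3) ne
        by (auto simp: doubleton_eq_iff hd_conv_nth last_conv_nth nth_eq_iff_index_eq)
      ultimately show "{p ! i, p ! Suc i} \<in> edges G - {?e}" by simp
    qed
    then have "reach (edges G - {?e}) (hd p) (last p)"
      using walk_reach ne by blast
    moreover have "?e \<in> edges G" using p(4) by (simp add: insert_commute)
    ultimately show False using F by (auto simp: forest_def)
  qed
qed

lemma tree_iff:
  "tree T \<longleftrightarrow> simple_graph T \<and> verts T \<noteq> {} \<and>
     (\<forall>u\<in>verts T. \<forall>v\<in>verts T. reach (edges T) u v) \<and> forest (edges T)"
proof (cases "simple_graph T")
  case True
  have "(\<exists>p. walk T p \<and> hd p = u \<and> last p = v) \<longleftrightarrow> reach (edges T) u v"
    if "u \<in> verts T" for u v
  proof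
    assume "\<exists>p. walk T p \<and> hd p = u \<and> last p = v"
    then show "reach (edges T) u v"
      using walk_reach unfolding walk_def by blast
  next
    assume "reach (edges T) u v"
    then show "\<exists>p. walk T p \<and> hd p = u \<and> last p = v"
      using reach_walk[OF True _ that] by blast
  qed
  then have "connected_graph T \<longleftrightarrow>
      verts T \<noteq> {} \<and> (\<forall>u\<in>verts T. \<forall>v\<in>verts T. reach (edges T) u v)"
    unfolding connected_graph_def by blast
  then show ?thesis
    using True no_cycle_iff_forest[OF True] by (auto simp: tree_def)
qed (simp add: tree_def)

lemma tree_simple: "tree T \<Longrightarrow> simple_graph T"
  by (simp add: tree_def)

lemma finite_edges: "simple_graph G \<Longrightarrow> finite (edges G)"
  unfolding simple_graph_def by (meson PowI finite_Pow_iff finite_subset subsetI)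

lemma simple_graph_edge:
  "simple_graph G \<Longrightarrow> {u, v} \<in> edges G \<Longrightarrow> u \<in> verts G \<and> v \<in> verts G \<and> u \<noteq> v"
  by (auto simp: simple_graph_def)

lemma edge_other_end:
  assumes "simple_graph G" "e \<in> edges G" "v \<in> e"
  obtains c where "e = {v, c}"
proof -
  have "card e = 2" using assms by (simp add: simple_graph_def)
  then obtain s t where "e = {s, t}" by (auto simp: card_2_iff)
  with \<open>v \<in> e\<close> have "e = {v, s} \<or> e = {v, t}" by auto
  then show ?thesis using that by blast
qed

lemma reach_verts:
  assumes "reach (edges G) u v" "simple_graph G" "u \<in> verts G"
  shows "v \<in> verts G"
  using assms by (induction rule: reach_induct) (auto dest: simple_graph_edge)

text \<open>The first crossing of the edge starts on the near side, where \<open>a\<close> does not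
  lie, so it leaves from \<open>x\<close>.\<close>

lemma walk_through_bridge:
  assumes "successively (\<lambda>u v. {u, v} \<in> E) p" "p \<noteq> []" "\<not> reach (E - {{x, a}}) (hd p) a"
  shows "reach (E - {{x, a}}) (hd p) (last p) \<or>
    (\<exists>q s. p = q @ s \<and> q \<noteq> [] \<and> s \<noteq> [] \<and> last q = x)"
  using assms
proof (induction p rule: rev_induct)
  case (snoc z q)
  show ?case
  proof (cases "q = []")
    case False
    then have E: "{last q, z} \<in> E" and q: "successively (\<lambda>u v. {u, v} \<in> E) q"
      using snoc.prems(1) by (auto simp: successively_append_iff)
    consider "reach (E - {{x, a}}) (hd q) (last q)"
      | "\<exists>r s. q = r @ s \<and> r \<noteq> [] \<and> s \<noteq> [] \<and> last r = x"
      using snoc.IH[OF q False] snoc.prems(3) False by auto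
    then show ?thesis
    proof cases
      case 1
      show ?thesis
      proof (cases "{last q, z} = {x, a}")
        case True
        then have "last q = x"
          using 1 snoc.prems(3) False by (auto simp: doubleton_eq_iff)
        with False show ?thesis by blast
      next
        case False
        then have "reach (E - {{x, a}}) (last q) z"
          using E by (intro reach_edge) auto
        with 1 \<open>q \<noteq> []\<close> show ?thesis by (auto intro: reach_trans)
      qed
    next
      case 2
      then obtain r s where "q = r @ s" "r \<noteq> []" "s \<noteq> []" "last r = x" by blast
      then have "q @ [z] = r @ (s @ [z])" by simp
      with \<open>r \<noteq> []\<close> \<open>last r = x\<close> show ?thesis by blast
    qed
  qed simp
qed simp

text \<open>Every walk from \<open>r\<close> to \<open>a\<close> visits \<open>x\<close> strictly
  before its end, so a shortest one contains a shorter walk to \<open>x\<close>.\<close>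

lemma childI:
  assumes T: "tree T" and xa: "{x, a} \<in> edges T" and r: "r \<in> verts T"
    and rx: "reach (edges T - {{x, a}}) r x"
  shows "child T r x a"
proof -
  have aV: "a \<in> verts T" and sg: "simple_graph T"
    using T xa tree_simple simple_graph_edge by metis+
  have na: "\<not> reach (edges T - {{x, a}}) r a"
    using T xa rx unfolding tree_iff by (meson forest_bridge reach_sym reach_trans)
  let ?P = "\<lambda>k. \<exists>p. walk T p \<and> hd p = r \<and> last p = a \<and> length p = Suc k"
  obtain p0 where "walk T p0" "hd p0 = r" "last p0 = a"
    using T r aV unfolding tree_def connected_graph_def by blast
  then have "?P (length p0 - 1)" by (intro exI[of _ p0]) (auto simp: walk_def)
  then have "?P (distance T r a)" unfolding distance_def by (rule LeastI)
  then obtain p where p: "walk T p" "hd p = r" "last p = a" "length p = Suc (distance T r a)"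
    by blast
  then obtain q s where q: "p = q @ s" "q \<noteq> []" "s \<noteq> []" "last q = x"
    using walk_through_bridge[of "edges T" p x a] na by (auto simp: walk_def)
  then have "walk T q" "hd q = r"
    using p by (auto simp: walk_def successively_append_iff)
  then have "distance T r x \<le> length q - 1"
    unfolding distance_def using q by (intro Least_le exI[of _ q]) auto
  moreover have "length q + length s = Suc (distance T r a)" "length s > 0" "length q > 0"
    using p(4) q by auto
  ultimately have "distance T r x < distance T r a"
    by linarith
  with xa show ?thesis by (simp add: child_def)
qed

section \<open>Exchanging two edges of a tree\<close>

lemma reach_lift:
  assumes "reach E s t" "\<And>u v. {u, v} \<in> E \<Longrightarrow> reach F u v"
  shows "reach F s t"
  using assms(1)
proof (induction rule: reach_induct)
  case (step y z)
  then show ?case using assms(2)[of y z] reach_trans[of F s y z] by blast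
qed simp

definition swap_edges :: "'a set set \<Rightarrow> 'a \<Rightarrow> 'a \<Rightarrow> 'a \<Rightarrow> 'a \<Rightarrow> 'a set set" where
  "swap_edges E x a y b = (E - {{x, a}, {y, b}}) \<union> {{x, b}, {y, a}}"

text \<open>Expresses without a root that the path between \<open>a\<close> and \<open>b\<close> in
  a tree starts with \<open>a\<close>, \<open>x\<close> and ends with \<open>y\<close>,
  \<open>b\<close>.\<close>

definition swappable :: "'a set set \<Rightarrow> 'a \<Rightarrow> 'a \<Rightarrow> 'a \<Rightarrow> 'a \<Rightarrow> bool" where
  "swappable E x a y b \<longleftrightarrow>
     x \<noteq> y \<and> {x, a} \<in> E \<and> {y, b} \<in> E \<and> reach (E - {{x, a}, {y, b}}) x y"

text \<open>A rootless form of the branch exchange, which is easily reversed and carried along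
  injections.\<close>

definition swap_step :: "'a sgraph \<Rightarrow> 'a sgraph \<Rightarrow> bool" where
  "swap_step T T' \<longleftrightarrow> tree T \<and> (\<exists>x a y b. degree T x = degree T y \<and>
     swappable (edges T) x a y b \<and>
     T' = \<lparr>verts = verts T, edges = swap_edges (edges T) x a y b\<rparr>)"

text \<open>Removing the two edges leaves three components, one with \<open>a\<close>, one with
  \<open>b\<close> and one with both \<open>x\<close> and \<open>y\<close>; any further connection
  would bypass a removed bridge.\<close>

lemma swappable_separated:
  assumes E: "forest E" and sw: "swappable E x a y b"
  defines "F \<equiv> E - {{x, a}, {y, b}}"
  shows "{x, a} \<noteq> {y, b}" "reach F x y"
    "\<not> reach F x a" "\<not> reach F x b" "\<not> reach F y a" "\<not> reach F y b" "\<not> reach F a b"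
proof -
  have xa: "\<not> reach (E - {{x, a}}) x a" and yb: "\<not> reach (E - {{y, b}}) y b"
    and ne: "x \<noteq> y"
    using E sw by (auto simp: swappable_def dest: forest_bridge)
  show xy: "reach F x y" using sw by (simp add: F_def swappable_def)
  have "F \<subseteq> E - {{x, a}}" "F \<subseteq> E - {{y, b}}" by (auto simp: F_def)
  then show nxa: "\<not> reach F x a" and nyb: "\<not> reach F y b"
    using xa yb reach_mono by metis+
  show "\<not> reach F x b" "\<not> reach F y a"
    using nxa nyb xy by (meson reach_sym reach_trans)+
  \<comment> \<open>Equal edges with \<open>x \<noteq> y\<close> would force \<open>a = y\<close>,
    although \<open>x\<close> still reaches \<open>y\<close>.\<close>
  show dist: "{x, a} \<noteq> {y, b}"
    using ne nxa xy by (auto simp: doubleton_eq_iff)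
  show "\<not> reach F a b"
  proof
    assume "reach F a b"
    moreover have "F \<subseteq> E - {{x, a}}" by (auto simp: F_def)
    ultimately have "reach (E - {{x, a}}) a b" "reach (E - {{x, a}}) x y"
      using xy reach_mono by metis+
    moreover have "reach (E - {{x, a}}) y b"
      using sw dist by (intro reach_edge) (auto simp: swappable_def)
    ultimately show False using xa by (meson reach_sym reach_trans)
  qed
qed

text \<open>The new edges are inserted one at a time, each between different components.\<close>

lemma forest_swap:
  assumes E: "forest E" and sw: "swappable E x a y b"
  shows "forest (swap_edges E x a y b)"
proof -
  define F where "F = E - {{x, a}, {y, b}}"
  note sep = swappable_separated[OF assms, folded F_def]
  have "forest F" using E by (rule forest_mono) (auto simp: F_def)
  then have "forest (insert {y, a} F)" using sep(5) by (rule forest_insert)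
  moreover have "\<not> reach (insert {y, a} F) x b"
    using sep reach_insert[of y a F x b] by blast
  ultimately have "forest (insert {x, b} (insert {y, a} F))" by (rule forest_insert)
  then show ?thesis by (simp add: swap_edges_def F_def insert_commute)
qed

lemma tree_swap:
  assumes T: "tree T" and sw: "swappable (edges T) x a y b"
  shows "tree \<lparr>verts = verts T, edges = swap_edges (edges T) x a y b\<rparr>"
proof -
  let ?E = "edges T" and ?E' = "swap_edges (edges T) x a y b"
  have sg: "simple_graph T" and F: "forest ?E" using T by (simp_all add: tree_iff)
  note sep = swappable_separated[OF F sw]
  have sub: "?E - {{x, a}, {y, b}} \<subseteq> ?E'" by (auto simp: swap_edges_def)
  have xy: "reach ?E' x y" using sep(2) sub by (rule reach_mono)
  have xb: "reach ?E' x b" and ya: "reach ?E' y a"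
    by (auto simp: swap_edges_def intro: reach_edge)
  \<comment> \<open>Each removed edge has a detour along the surviving path between \<open>x\<close>
    and \<open>y\<close> and one new edge.\<close>
  have "reach ?E' u v" if "{u, v} \<in> ?E" for u v
  proof -
    consider "{u, v} = {x, a}" | "{u, v} = {y, b}" | "{u, v} \<in> ?E'"
      using \<open>{u, v} \<in> ?E\<close> sub by blast
    then show ?thesis
    proof cases
      case 1
      moreover have "reach ?E' x a" using xy ya by (rule reach_trans)
      ultimately show ?thesis by (metis doubleton_eq_iff reach_sym)
    next
      case 2
      moreover have "reach ?E' y b" using reach_sym[OF xy] xb by (rule reach_trans)
      ultimately show ?thesis by (metis doubleton_eq_iff reach_sym)
    qed (rule reach_edge)
  qed
  then have "reach ?E' u v" if "u \<in> verts T" "v \<in> verts T" for u v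
    using T that reach_lift[of ?E u v ?E'] by (simp add: tree_iff)
  moreover have "simple_graph \<lparr>verts = verts T, edges = ?E'\<rparr>"
  proof -
    have "x \<noteq> b" "y \<noteq> a" using sep by auto
    moreover have "x \<in> verts T" "a \<in> verts T" "y \<in> verts T" "b \<in> verts T"
      using sw simple_graph_edge[OF sg] by (auto simp: swappable_def)
    ultimately show ?thesis
      using sg by (auto simp: simple_graph_def swap_edges_def)
  qed
  ultimately show ?thesis
    using T forest_swap[OF F sw] by (simp add: tree_iff)
qed

lemma swap_step_imp_branch_exchange:
  assumes "swap_step T T'"
  shows "branch_exchange T T'"
proof -
  obtain x a y b where T: "tree T" and deg: "degree T x = degree T y"
    and sw: "swappable (edges T) x a y b"
    and T': "T' = \<lparr>verts = verts T, edges = swap_edges (edges T) x a y b\<rparr>"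
    using assms by (auto simp: swap_step_def)
  have e: "{x, a} \<in> edges T" "{y, b} \<in> edges T" and ne: "x \<noteq> y"
    and xy: "reach (edges T - {{x, a}, {y, b}}) x y"
    using sw by (auto simp: swappable_def)
  have V: "x \<in> verts T" "y \<in> verts T"
    using e simple_graph_edge[OF tree_simple[OF T]] by blast+
  have "reach (edges T - {{y, b}}) x y"
    using xy by (rule reach_mono) auto
  \<comment> \<open>With \<open>x\<close> as the root, both \<open>a\<close> and \<open>b\<close>
    are at the far ends of their edges.\<close>
  then have "child T x x a" "child T x y b"
    using childI[OF T] e V by auto
  then show ?thesis
    using T T' V deg ne tree_swap[OF T sw] unfolding branch_exchange_def swap_edges_def
    by blast
qed

section \<open>Effect of an exchange on degrees and on \<open>SO\<close>\<close>

lemma exchange_new_edge: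
  assumes T: "tree T" and T': "tree T'" and V: "verts T' = verts T"
    and E': "edges T' = (edges T - {{x, a}, {y, b}}) \<union> {{x, b}, {y, a}}"
    and e: "{x, a} \<in> edges T" "{y, b} \<in> edges T" and ne: "x \<noteq> y" "a \<noteq> b"
  shows "{x, b} \<notin> edges T"
proof
  assume xb: "{x, b} \<in> edges T"
  define F where "F = edges T - {{x, a}, {y, b}}"
  \<comment> \<open>An edge \<open>{x, b}\<close> already present would survive the removals, since
    \<open>x \<noteq> y\<close> and \<open>a \<noteq> b\<close>; only \<open>{y, a}\<close> could
    then be new.\<close>
  have xbF: "{x, b} \<in> F" using xb ne by (auto simp: F_def doubleton_eq_iff)
  have "F \<subseteq> edges T - {{x, a}}" "F \<subseteq> edges T - {{y, b}}" by (auto simp: F_def)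
  moreover have "\<not> reach (edges T - {{x, a}}) x a" "\<not> reach (edges T - {{y, b}}) y b"
    using T e by (auto simp: tree_iff dest: forest_bridge)
  ultimately have nxa: "\<not> reach F x a" and nyb: "\<not> reach F y b"
    using reach_mono by metis+
  have "reach (edges T') x a"
    using T' V e simple_graph_edge[OF tree_simple[OF T]] unfolding tree_iff by blast
  then have "reach (insert {y, a} F) x a"
    by (rule reach_mono) (use xbF in \<open>auto simp: E' F_def\<close>)
  \<comment> \<open>The path in \<open>T'\<close> must cross \<open>{y, a}\<close>, hence
    \<open>F\<close> joins \<open>x\<close> to \<open>y\<close>; followed by \<open>{x, b}\<close>
    this bypasses the bridge \<open>{y, b}\<close>.\<close>
  then have "reach F x y"
    using reach_insert[of y a F x a] nxa by blast
  then show False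
    using nyb reach_edge[OF xbF] by (meson reach_sym reach_trans)
qed

text \<open>The common remainder \<open>F\<close>, which contains none of the four edges, reduces
  degrees and \<open>SO\<close> to comparing two edges with two edges.\<close>

lemma exchange_edges:
  assumes T: "tree T" and T': "tree T'" and V: "verts T' = verts T"
    and E': "edges T' = (edges T - {{x, a}, {y, b}}) \<union> {{x, b}, {y, a}}"
    and e: "{x, a} \<in> edges T" "{y, b} \<in> edges T" and ne: "x \<noteq> y" "a \<noteq> b"
  shows "\<exists>F. finite F \<and> edges T = insert {x, a} (insert {y, b} F) \<and>
    edges T' = insert {x, b} (insert {y, a} F) \<and>
    {x, a} \<notin> F \<and> {y, b} \<notin> F \<and> {x, b} \<notin> F \<and> {y, a} \<notin> F \<and>
    {x, a} \<noteq> {y, b} \<and> {x, b} \<noteq> {y, a} \<and> x \<noteq> a \<and> y \<noteq> b \<and> x \<noteq> b \<and> y \<noteq> a"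
proof -
  have d: "x \<noteq> a" "y \<noteq> b" "x \<noteq> b" "y \<noteq> a"
    using simple_graph_edge[OF tree_simple[OF T] e(1)] simple_graph_edge[OF tree_simple[OF T] e(2)]
      simple_graph_edge[OF tree_simple[OF T'], of x b]
      simple_graph_edge[OF tree_simple[OF T'], of y a] E'
    by simp_all
  have "{x, b} \<notin> edges T"
    by (rule exchange_new_edge[OF assms])
  moreover have "{y, a} \<notin> edges T"
    using exchange_new_edge[OF T T' V _ e(2,1)] E' ne by (simp add: insert_commute)
  moreover have "finite (edges T - {{x, a}, {y, b}})"
    using finite_edges[OF tree_simple[OF T]] by simp
  ultimately show ?thesis
    using d e ne E' by (intro exI[of _ "edges T - {{x, a}, {y, b}}"]) (auto simp: doubleton_eq_iff)
qed

lemma exchange_degree: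
  assumes T: "tree T" and T': "tree T'" and V: "verts T' = verts T"
    and E': "edges T' = (edges T - {{x, a}, {y, b}}) \<union> {{x, b}, {y, a}}"
    and e: "{x, a} \<in> edges T" "{y, b} \<in> edges T" and ne: "x \<noteq> y"
  shows "degree T' = degree T"
proof (cases "a = b")
  \<comment> \<open>The hypotheses admit \<open>a = b\<close>, in which case the exchange changes
    nothing.\<close>
  case True
  then have "edges T' = edges T" using E' e by auto
  then show ?thesis by (simp add: degree_def fun_eq_iff)
next
  case False
  obtain F where F: "finite F" "edges T = insert {x, a} (insert {y, b} F)"
    "edges T' = insert {x, b} (insert {y, a} F)"
    "{x, a} \<notin> F" "{y, b} \<notin> F" "{x, b} \<notin> F" "{y, a} \<notin> F"
    "{x, a} \<noteq> {y, b}" "{x, b} \<noteq> {y, a}" "x \<noteq> a" "y \<noteq> b" "x \<noteq> b" "y \<noteq> a"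
    using exchange_edges[OF assms False] by (elim exE conjE) (rule that)
  have *: "card {e \<in> insert f (insert g F). v \<in> e} =
      of_bool (v \<in> f) + of_bool (v \<in> g) + card {e \<in> F. v \<in> e}"
    if "f \<notin> F" "g \<notin> F" "f \<noteq> g" for f g and v :: 'a
  proof -
    have "{e \<in> insert f (insert g F). v \<in> e} =
        (if v \<in> f then {f} else {}) \<union> (if v \<in> g then {g} else {}) \<union> {e \<in> F. v \<in> e}"
      by auto
    then show ?thesis using that F(1) by (simp add: card_insert_if)
  qed
  show ?thesis
  proof
    fix v
    have "degree T' v = of_bool (v \<in> {x, b}) + of_bool (v \<in> {y, a}) + card {e \<in> F. v \<in> e}"
      unfolding degree_def F(3) by (rule *) (use F in auto)
    moreover have
      "degree T v = of_bool (v \<in> {x, a}) + of_bool (v \<in> {y, b}) + card {e \<in> F. v \<in> e}"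
      unfolding degree_def F(2) by (rule *) (use F in auto)
    ultimately show "degree T' v = degree T v"
      using F(10-13) ne False by auto
  qed
qed

text \<open>Degrees are unchanged, so only the weights of the removed and the added edges
  differ.\<close>

lemma exchange_SO:
  assumes T: "tree T" and T': "tree T'" and V: "verts T' = verts T"
    and E': "edges T' = (edges T - {{x, a}, {y, b}}) \<union> {{x, b}, {y, a}}"
    and e: "{x, a} \<in> edges T" "{y, b} \<in> edges T" and ne: "x \<noteq> y"
  defines "w \<equiv> \<lambda>u v. sqrt ((real (degree T u))\<^sup>2 + (real (degree T v))\<^sup>2)"
  shows "SO T' + w x a + w y b = SO T + w x b + w y a"
proof (cases "a = b")
  case True
  then have "edges T' = edges T" using E' e by auto
  then have "SO T' = SO T" by (simp add: SO_def degree_def)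
  then show ?thesis using True by simp
next
  case False
  have deg: "degree T' = degree T" using assms(1-7) by (rule exchange_degree)
  obtain F where F: "finite F" "edges T = insert {x, a} (insert {y, b} F)"
    "edges T' = insert {x, b} (insert {y, a} F)"
    "{x, a} \<notin> F" "{y, b} \<notin> F" "{x, b} \<notin> F" "{y, a} \<notin> F"
    "{x, a} \<noteq> {y, b}" "{x, b} \<noteq> {y, a}" "x \<noteq> a" "y \<noteq> b" "x \<noteq> b" "y \<noteq> a"
    using exchange_edges[OF assms(1-7) False] by (elim exE conjE) (rule that)
  define f where "f = (\<lambda>e. sqrt (\<Sum>v\<in>e. (real (degree T v))\<^sup>2))"
  have "f {u, v} = w u v" if "u \<noteq> v" for u v
    using that by (simp add: f_def w_def)
  moreover have "SO T = f {x, a} + (f {y, b} + sum f F)"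
    unfolding SO_def F(2) f_def[symmetric] using F by simp
  moreover have "SO T' = f {x, b} + (f {y, a} + sum f F)"
    unfolding SO_def F(3) deg f_def[symmetric] using F by simp
  ultimately show ?thesis using F by simp
qed

lemma degree_sequence_cong:
  "verts T' = verts T \<Longrightarrow> degree T' = degree T \<Longrightarrow> degree_sequence T' = degree_sequence T"
  by (simp add: degree_sequence_def)

lemma branch_exchange_tree: "branch_exchange T T' \<Longrightarrow> tree T'"
  by (auto simp: branch_exchange_def)

lemma branch_exchange_SO:
  assumes "branch_exchange T T'"
  shows "SO T' = SO T"
proof -
  obtain x y a b where *: "tree T" "x \<noteq> y" "degree T x = degree T y"
      "{x, a} \<in> edges T" "{y, b} \<in> edges T"
      "T' = \<lparr>verts = verts T, edges = (edges T - {{x, a}, {y, b}}) \<union> {{x, b}, {y, a}}\<rparr>" "tree T'"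
    using assms by (auto simp: branch_exchange_def child_def)
  then show ?thesis using exchange_SO[of T T' x a y b] by simp
qed

section \<open>Degree conditions in trees of minimal \<open>SO\<close>\<close>

lemma sqrt_exchange_less:
  fixes A B p q :: real
  assumes "B < A" "p < q" "0 \<le> B" "0 \<le> p"
  shows "sqrt (A + q) + sqrt (B + p) < sqrt (A + p) + sqrt (B + q)"
proof (rule power2_less_imp_less)
  \<comment> \<open>The radicands have the same sum on both sides, so the squares are compared by
    the products, whose difference is \<open>(A - B) * (q - p)\<close>.\<close>
  have "(A + q) * (B + p) < (A + p) * (B + q)"
    using mult_strict_mono[of 0 "A - B" 0 "q - p"] assms by (simp add: algebra_simps)
  then have "sqrt (A + q) * sqrt (B + p) < sqrt (A + p) * sqrt (B + q)"
    by (simp flip: real_sqrt_mult)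
  then show "(sqrt (A + q) + sqrt (B + p))\<^sup>2 < (sqrt (A + p) + sqrt (B + q))\<^sup>2"
    using assms by (simp add: power2_sum)
qed (use assms in simp)

text \<open>Competitors may use any vertices of the type \<open>'a\<close>, as in the set over which
  the theorem minimizes.\<close>

definition optimal :: "'a sgraph \<Rightarrow> bool" where
  "optimal T \<longleftrightarrow> tree T \<and>
     (\<forall>S :: 'a sgraph. tree S \<longrightarrow> degree_sequence S = degree_sequence T \<longrightarrow> SO T \<le> SO S)"

lemma optimal_swappable:
  assumes T: "optimal T" and sw: "swappable (edges T) x a y b"
    and xy: "degree T y < degree T x"
  shows "degree T b \<le> degree T a"
proof (rule ccontr)
  assume "\<not> ?thesis"
  then have ab: "degree T a < degree T b" by simp
  define T' where "T' = \<lparr>verts = verts T, edges = swap_edges (edges T) x a y b\<rparr>"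
  have tT: "tree T" using T by (simp add: optimal_def)
  have tT': "tree T'" unfolding T'_def using tT sw by (rule tree_swap)
  have ex: "verts T' = verts T"
      "edges T' = (edges T - {{x, a}, {y, b}}) \<union> {{x, b}, {y, a}}"
      "{x, a} \<in> edges T" "{y, b} \<in> edges T" "x \<noteq> y"
    using sw by (auto simp: T'_def swap_edges_def swappable_def)
  have "degree_sequence T' = degree_sequence T"
    using exchange_degree[OF tT tT' ex] ex(1) by (intro degree_sequence_cong)
  then have "SO T \<le> SO T'" using T tT' by (simp add: optimal_def)
  \<comment> \<open>The new edges join the larger degrees with each other and the smaller ones with
    each other, which is cheaper by strict concavity.\<close>
  moreover have "SO T' < SO T"
    using exchange_SO[OF tT tT' ex] xy ab
      sqrt_exchange_less[of "(real (degree T y))\<^sup>2" "(real (degree T x))\<^sup>2"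
        "(real (degree T a))\<^sup>2" "(real (degree T b))\<^sup>2"]
    by (simp add: power_strict_mono)
  ultimately show False by simp
qed

text \<open>The condition of lemma \<open>optimal_swappable\<close> would force the degrees to grow forever along a
  path leaving \<open>x\<close> through \<open>u\<close> once a degree beyond \<open>u\<close> exceeds that of \<open>u\<close>.\<close>

lemma optimal_degree_beyond:
  assumes T: "optimal T" and xu: "{x, u} \<in> edges T"
    and le: "\<And>z. reach (edges T - {{x, u}}) u z \<Longrightarrow> degree T z \<le> degree T x"
    and v: "reach (edges T - {{x, u}}) u v"
  shows "degree T v \<le> degree T u"
proof (rule ccontr)
  define E1 where "E1 = edges T - {{x, u}}"
  have tT: "tree T" using T by (simp add: optimal_def)
  have sg: "simple_graph T" using tT by (rule tree_simple)
  have fin: "finite (verts T)" using sg by (simp add: simple_graph_def)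
  have FT: "forest (edges T)" using tT by (simp add: tree_iff)
  then have F1: "forest E1" by (rule forest_mono) (auto simp: E1_def)
  have uV: "u \<in> verts T" using simple_graph_edge[OF sg xu] by simp
  have nux: "\<not> reach E1 u x"
    using forest_bridge[OF FT xu] reach_sym unfolding E1_def by metis
  \<comment> \<open>Hence a vertex of larger degree than \<open>u\<close> has degree at least two,
    and a path arriving there can continue.\<close>
  have du: "degree T u \<ge> 1"
  proof -
    have "{x, u} \<in> {e \<in> edges T. u \<in> e}" using xu by simp
    then have "card {e \<in> edges T. u \<in> e} > 0"
      unfolding card_gt_0_iff using finite_edges[OF sg] by auto
    then show ?thesis by (simp add: degree_def)
  qed
  \<comment> \<open>Infinite descent on the number of vertices that removing \<open>{p, v}\<close>
    leaves unreachable from \<open>u\<close>: a vertex \<open>v\<close> of larger degree than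
    \<open>u\<close> always has a neighbour further out with the same property.\<close>
  have desc: "\<not> (\<exists>p. {p, v} \<in> E1 \<and> reach (E1 - {{p, v}}) u p \<and> degree T u < degree T v \<and>
      card {z \<in> verts T. \<not> reach (E1 - {{p, v}}) u z} = m)" for v m
  proof (induction m arbitrary: v rule: less_induct)
    case (less m)
    show ?case
    proof
      assume "\<exists>p. {p, v} \<in> E1 \<and> reach (E1 - {{p, v}}) u p \<and> degree T u < degree T v \<and>
        card {z \<in> verts T. \<not> reach (E1 - {{p, v}}) u z} = m"
      then obtain p where p: "{p, v} \<in> E1" "reach (E1 - {{p, v}}) u p"
        and dv: "degree T u < degree T v"
        and m: "card {z \<in> verts T. \<not> reach (E1 - {{p, v}}) u z} = m"
        by blast
      have npv: "\<not> reach (E1 - {{p, v}}) p v" using F1 p(1) by (rule forest_bridge)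
      have nuv: "\<not> reach (E1 - {{p, v}}) u v"
        using npv p(2) by (meson reach_sym reach_trans)
      have pvT: "{p, v} \<in> edges T" using p(1) by (simp add: E1_def)
      have uv: "reach E1 u v"
        using reach_mono[OF p(2), of E1] reach_edge[OF p(1)] reach_trans[of E1 u p v] by blast
      have "\<exists>e. e \<in> edges T \<and> v \<in> e \<and> e \<noteq> {p, v}"
      proof (rule ccontr)
        assume "\<nexists>e. e \<in> edges T \<and> v \<in> e \<and> e \<noteq> {p, v}"
        then have "{e \<in> edges T. v \<in> e} \<subseteq> {{p, v}}" by blast
        then have "degree T v \<le> card {{p, v}}" unfolding degree_def by (intro card_mono) simp_all
        then show False using dv du by simp
      qed
      then obtain e where e: "e \<in> edges T" "v \<in> e" "e \<noteq> {p, v}" by blast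
      then obtain c where c: "e = {v, c}"
        using edge_other_end[OF sg] by blast
      have vcT: "{v, c} \<in> edges T" and cp: "c \<noteq> p" using e c by (auto simp: insert_commute)
      have "v \<noteq> u" using dv by auto
      have "v \<noteq> x" using uv nux by auto
      then have vc: "{v, c} \<in> E1"
        using vcT \<open>v \<noteq> u\<close> by (auto simp: E1_def doubleton_eq_iff)
      have pv_vc: "{p, v} \<noteq> {v, c}" using cp by (auto simp: doubleton_eq_iff)
      have comm: "E1 - {{p, v}} - {{v, c}} \<subseteq> E1 - {{p, v}}" "E1 - {{p, v}} - {{v, c}} \<subseteq> E1 - {{v, c}}"
        by auto
      have vcpv: "{v, c} \<in> E1 - {{p, v}}" using vc pv_vc by auto
      \<comment> \<open>Crossing \<open>{v, c}\<close> would mean visiting \<open>v\<close>, which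
        is not on the side of \<open>u\<close> once \<open>{p, v}\<close> is removed.\<close>
      have keep: "reach (E1 - {{v, c}}) u z" if z: "reach (E1 - {{p, v}}) u z" for z
      proof -
        let ?G = "E1 - {{p, v}} - {{v, c}}"
        have "\<not> reach ?G u v" using nuv reach_mono[OF _ comm(1), of u v] by blast
        moreover have "\<not> reach ?G u c"
          using nuv reach_mono[OF _ comm(1), of u c] reach_sym[OF reach_edge[OF vcpv]]
            reach_trans[of "E1 - {{p, v}}" u c v] by blast
        ultimately have "reach ?G u z" using reach_remove[OF z, of v c] by blast
        then show ?thesis using comm(2) by (rule reach_mono)
      qed
      have "reach (E1 - {{v, c}}) p v"
        using p(1) pv_vc by (intro reach_edge) auto
      then have uv': "reach (E1 - {{v, c}}) u v"
        using keep[OF p(2)] by (rule reach_trans[rotated])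
      \<comment> \<open>On the path from \<open>c\<close> through \<open>v\<close> and
        \<open>u\<close> to \<open>x\<close>, minimality and \<open>degree T u < degree T v\<close>
        give \<open>degree T x \<le> degree T c\<close>; with \<open>le\<close> for \<open>v\<close>
        it follows that \<open>c\<close> exceeds \<open>u\<close> in degree as well.\<close>
      have "swappable (edges T) v c u x"
        unfolding swappable_def
      proof (intro conjI)
        show "{u, x} \<in> edges T" using xu by (simp add: insert_commute)
        have "E1 - {{v, c}} \<subseteq> edges T - {{v, c}, {u, x}}" by (auto simp: E1_def)
        then show "reach (edges T - {{v, c}, {u, x}}) v u"
          using reach_sym[OF uv'] by (rule reach_mono[rotated])
      qed (use vcT \<open>v \<noteq> u\<close> in auto)
      then have "degree T x \<le> degree T c"
        using optimal_swappable[OF T] dv by blast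
      moreover have "degree T v \<le> degree T x" using le uv unfolding E1_def by blast
      ultimately have dc: "degree T u < degree T c" using dv by simp
      \<comment> \<open>The vertex \<open>v\<close> itself moves to the side of \<open>u\<close>,
        which makes the inclusion strict.\<close>
      have "{z \<in> verts T. \<not> reach (E1 - {{v, c}}) u z} \<subset> {z \<in> verts T. \<not> reach (E1 - {{p, v}}) u z}"
      proof
        show "{z \<in> verts T. \<not> reach (E1 - {{v, c}}) u z} \<subseteq> {z \<in> verts T. \<not> reach (E1 - {{p, v}}) u z}"
          using keep by blast
        have "v \<in> verts T" using simple_graph_edge[OF sg pvT] by simp
        then show "{z \<in> verts T. \<not> reach (E1 - {{v, c}}) u z} \<noteq> {z \<in> verts T. \<not> reach (E1 - {{p, v}}) u z}"
          using uv' nuv by blast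
      qed
      then have "card {z \<in> verts T. \<not> reach (E1 - {{v, c}}) u z} < m"
        unfolding m[symmetric] using fin by (intro psubset_card_mono) auto
      from less.IH[OF this] vc uv' dc show False by blast
    qed
  qed
  assume "\<not> degree T v \<le> degree T u"
  then have dv: "degree T u < degree T v" by simp
  then have "u \<noteq> v" by auto
  then obtain p where "{p, v} \<in> E1" "reach (E1 - {{p, v}}) u p"
    using reach_last_edge[OF v] unfolding E1_def by blast
  with dv desc show False by blast
qed

section \<open>Invariance and reversibility of exchanges\<close>

lemma swap_step_invariants:
  assumes "swap_step T T'"
  shows "tree T'" "verts T' = verts T" "degree T' = degree T" "SO T' = SO T"
    and "optimal T \<Longrightarrow> optimal T'"
proof -
  obtain x a y b where T: "tree T" and deg: "degree T x = degree T y"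
    and sw: "swappable (edges T) x a y b"
    and T': "T' = \<lparr>verts = verts T, edges = swap_edges (edges T) x a y b\<rparr>"
    using assms by (auto simp: swap_step_def)
  show tT': "tree T'" unfolding T' using T sw by (rule tree_swap)
  show V: "verts T' = verts T" using T' by simp
  show d: "degree T' = degree T"
    using sw T' by (intro exchange_degree[OF T tT' V, of x a y b])
      (auto simp: swappable_def swap_edges_def)
  show SO: "SO T' = SO T"
    using assms by (intro branch_exchange_SO swap_step_imp_branch_exchange)
  show "optimal T'" if "optimal T"
    using that tT' SO degree_sequence_cong[OF V d] by (simp add: optimal_def)
qed

lemma swap_step_sym:
  assumes "swap_step T T'"
  shows "swap_step T' T"
proof -
  obtain x a y b where T: "tree T" and deg: "degree T x = degree T y"
    and sw: "swappable (edges T) x a y b"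
    and T': "T' = \<lparr>verts = verts T, edges = swap_edges (edges T) x a y b\<rparr>"
    using assms by (auto simp: swap_step_def)
  have tT': "tree T'" and d: "degree T' = degree T"
    using swap_step_invariants[OF assms] by auto
  have F: "forest (edges T)" using T by (simp add: tree_iff)
  note sep = swappable_separated[OF F sw]
  let ?F = "edges T - {{x, a}, {y, b}}"
  \<comment> \<open>Both new edges join different components of \<open>?F\<close>, so removing them
    from \<open>T'\<close> gives back exactly \<open>?F\<close>.\<close>
  have "{x, b} \<notin> ?F" "{y, a} \<notin> ?F"
    using sep reach_edge by metis+
  then have "edges T' - {{x, b}, {y, a}} = ?F"
    by (auto simp: T' swap_edges_def)
  then have "swappable (edges T') x b y a" and "swap_edges (edges T') x b y a = edges T"
    using sep(2) sw by (auto simp: swappable_def swap_edges_def T')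
  then show ?thesis
    using tT' deg d T' unfolding swap_step_def
    by (metis old.unit.exhaust select_convs(1) surjective)
qed

section \<open>Isomorphic copies\<close>

text \<open>Images under maps injective on the vertices make isomorphic copies explicit, so that the
  greedy tree on numbers can be compared with trees on other vertex types.\<close>

definition map_graph :: "('a \<Rightarrow> 'b) \<Rightarrow> 'a sgraph \<Rightarrow> 'b sgraph" where
  "map_graph f G = \<lparr>verts = f ` verts G, edges = (`) f ` edges G\<rparr>"

lemma map_graph_sel [simp]:
  "verts (map_graph f G) = f ` verts G" "edges (map_graph f G) = (`) f ` edges G"
  by (simp_all add: map_graph_def)

lemma sgraph_eqI:
  fixes G H :: "'a sgraph"
  shows "verts G = verts H \<Longrightarrow> edges G = edges H \<Longrightarrow> G = H"
  by (cases G, cases H) simp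

lemma inj_on_edges:
  "simple_graph G \<Longrightarrow> inj_on f (verts G) \<Longrightarrow> inj_on ((`) f) (edges G)"
  by (rule inj_on_subset[OF inj_on_image_Pow]) (auto simp: simple_graph_def)

lemma simple_map_graph:
  assumes "simple_graph G" "inj_on f (verts G)"
  shows "simple_graph (map_graph f G)"
proof -
  have "card (f ` e) = 2" if "e \<in> edges G" for e
    using that assms by (metis card_image inj_on_subset simple_graph_def)
  then show ?thesis using assms by (auto simp: simple_graph_def)
qed

lemma map_graph_inv:
  assumes "simple_graph G" "inj_on f (verts G)"
  shows "map_graph (inv_into (verts G) f) (map_graph f G) = G"
proof (rule sgraph_eqI)
  have "inv_into (verts G) f ` f ` e = e" if "e \<subseteq> verts G" for e
    using assms(2) that by (rule inv_into_image_cancel)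
  then show "verts (map_graph (inv_into (verts G) f) (map_graph f G)) = verts G"
    "edges (map_graph (inv_into (verts G) f) (map_graph f G)) = edges G"
    using assms(1) by (simp_all add: simple_graph_def image_comp)
qed

lemma reach_map:
  assumes "reach E u v"
  shows "reach ((`) f ` E) (f u) (f v)"
  using assms
proof (induction rule: reach_induct)
  case (step y z)
  have "{f y, f z} \<in> (`) f ` E" using step.hyps(2) by (auto intro: image_eqI[of _ _ "{y, z}"])
  with step.IH show ?case using reach_edge reach_trans by metis
qed simp

text \<open>A detour around an image edge pulls back along the inverse of \<open>f\<close> to a
  detour around the original edge, so bridges remain bridges.\<close>

lemma tree_map_graph:
  assumes T: "tree T" and f: "inj_on f (verts T)"
  shows "tree (map_graph f T)"
proof -
  have sg: "simple_graph T" using T by (rule tree_simple)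
  let ?g = "inv_into (verts T) f"
  have g: "?g (f v) = v" if "v \<in> verts T" for v using f that by simp
  have ge: "?g ` f ` e = e" if "e \<in> edges T" for e
    using f sg that by (intro inv_into_image_cancel) (auto simp: simple_graph_def)
  have "forest ((`) f ` edges T)"
    unfolding forest_def
  proof (intro allI impI notI)
    fix s t
    assume "{s, t} \<in> (`) f ` edges T" and r: "reach ((`) f ` edges T - {{s, t}}) s t"
    then obtain e where e: "e \<in> edges T" "{s, t} = f ` e" by blast
    then obtain u v where uv: "s = f u" "t = f v" "u \<in> e" "v \<in> e" by (metis image_iff insertCI)
    have V: "u \<in> verts T" "v \<in> verts T" using e uv sg by (auto simp: simple_graph_def)
    have euv: "e = {u, v}"
      using ge[OF e(1)] g V uv by (simp flip: e(2))
    have "(`) ?g ` ((`) f ` edges T - {{s, t}}) \<subseteq> edges T - {e}"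
    proof
      fix d'
      assume "d' \<in> (`) ?g ` ((`) f ` edges T - {{s, t}})"
      then obtain h where h: "h \<in> (`) f ` edges T - {{s, t}}" "d' = ?g ` h"
        by (rule imageE)
      then obtain d where d: "d \<in> edges T" "h = f ` d" by (elim DiffE imageE)
      have "d \<noteq> e" using h(1) d(2) e(2) by (intro notI) simp
      moreover have "d' = d" using ge[OF d(1)] h(2) d(2) by simp
      ultimately show "d' \<in> edges T - {e}" using d(1) by simp
    qed
    with reach_map[OF r, of ?g] have "reach (edges T - {e}) (?g s) (?g t)"
      by (rule reach_mono)
    then have "reach (edges T - {e}) u v"
      using g V uv by simp
    with T euv e(1) show False by (auto simp: tree_iff dest: forest_bridge)
  qed
  then show ?thesis
    using T simple_map_graph[OF sg f] by (auto simp: tree_iff intro: reach_map)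
qed

lemma degree_map_graph:
  assumes sg: "simple_graph G" and f: "inj_on f (verts G)" and v: "v \<in> verts G"
  shows "degree (map_graph f G) (f v) = degree G v"
proof -
  have "f v \<in> f ` e \<longleftrightarrow> v \<in> e" if "e \<in> edges G" for e
    using that sg f v by (meson inj_on_image_mem_iff simple_graph_def)
  then have "{e \<in> edges (map_graph f G). f v \<in> e} = (`) f ` {e \<in> edges G. v \<in> e}"
    by auto
  moreover have "inj_on ((`) f) {e \<in> edges G. v \<in> e}"
    using inj_on_edges[OF sg f] by (rule inj_on_subset) auto
  ultimately show ?thesis by (simp add: degree_def card_image)
qed

lemma SO_map_graph:
  assumes sg: "simple_graph G" and f: "inj_on f (verts G)"
  shows "SO (map_graph f G) = SO G"
proof -
  have "(\<Sum>v\<in>f ` e. (real (degree (map_graph f G) v))\<^sup>2) = (\<Sum>v\<in>e. (real (degree G v))\<^sup>2)"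
    if "e \<in> edges G" for e
  proof -
    have e: "e \<subseteq> verts G" using sg that by (simp add: simple_graph_def)
    then have "inj_on f e" using f inj_on_subset by blast
    then show ?thesis
      using e degree_map_graph[OF sg f]
      by (auto simp: sum.reindex intro!: sum.cong)
  qed
  then show ?thesis
    unfolding SO_def map_graph_sel by (simp add: sum.reindex[OF inj_on_edges[OF sg f]])
qed

lemma isomorphic_map_graph:
  assumes sg: "simple_graph G" and f: "inj_on f (verts G)"
  shows "isomorphic G (map_graph f G)"
proof -
  have "{u, v} \<in> edges G \<longleftrightarrow> {f u, f v} \<in> (`) f ` edges G" if "u \<in> verts G" "v \<in> verts G" for u v
  proof
    assume "{f u, f v} \<in> (`) f ` edges G"
    then obtain e where e: "e \<in> edges G" "f ` {u, v} = f ` e" by auto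
    then have "{u, v} = e"
      using f that sg by (subst (asm) inj_on_image_eq_iff[of f "verts G"]) (auto simp: simple_graph_def)
    with e show "{u, v} \<in> edges G" by simp
  qed (auto intro: image_eqI[of _ _ "{u, v}"])
  with f show ?thesis
    unfolding isomorphic_def by (intro exI[of _ f]) (simp add: inj_on_imp_bij_betw)
qed

lemma isomorphic_imp_map_graph:
  assumes iso: "isomorphic G H" and G: "simple_graph G" and H: "simple_graph H"
  obtains f where "inj_on f (verts G)" "H = map_graph f G"
proof -
  obtain f where f: "bij_betw f (verts G) (verts H)"
    and fe: "\<And>u v. u \<in> verts G \<Longrightarrow> v \<in> verts G \<Longrightarrow> {u, v} \<in> edges G \<longleftrightarrow> {f u, f v} \<in> edges H"
    using iso by (auto simp: isomorphic_def)
  have V: "verts H = f ` verts G" using f by (simp add: bij_betw_def)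
  have "edges H = (`) f ` edges G"
  proof (intro equalityI subsetI)
    fix e assume e: "e \<in> edges H"
    then obtain s t where st: "e = {s, t}" using H by (metis card_2_iff simple_graph_def)
    then have "s \<in> f ` verts G" "t \<in> f ` verts G"
      using e simple_graph_edge[OF H] V by auto
    then obtain u v where "u \<in> verts G" "v \<in> verts G" "s = f u" "t = f v" by blast
    then have "{u, v} \<in> edges G" "e = f ` {u, v}" using fe st e by auto
    then show "e \<in> (`) f ` edges G" by blast
  next
    fix e assume "e \<in> (`) f ` edges G"
    then obtain e' where e': "e' \<in> edges G" "e = f ` e'" by blast
    then obtain u v where uv: "e' = {u, v}" using G by (metis card_2_iff simple_graph_def)
    then have "u \<in> verts G" "v \<in> verts G" using e' simple_graph_edge[OF G] by auto
    with e' uv fe show "e \<in> edges H" by auto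
  qed
  with V f have "H = map_graph f G" "inj_on f (verts G)"
    by (auto intro: sgraph_eqI simp: bij_betw_def)
  then show ?thesis using that by blast
qed

lemma swap_step_map_graph:
  assumes st: "swap_step T T'" and f: "inj_on f (verts T)"
  shows "swap_step (map_graph f T) (map_graph f T')"
proof -
  obtain x a y b where T: "tree T" and deg: "degree T x = degree T y"
    and sw: "swappable (edges T) x a y b"
    and T': "T' = \<lparr>verts = verts T, edges = swap_edges (edges T) x a y b\<rparr>"
    using st by (auto simp: swap_step_def)
  have sg: "simple_graph T" using T by (rule tree_simple)
  have e: "{x, a} \<in> edges T" "{y, b} \<in> edges T" and ne: "x \<noteq> y"
    using sw by (auto simp: swappable_def)
  have V: "x \<in> verts T" "y \<in> verts T"
    using e simple_graph_edge[OF sg] by blast+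
  \<comment> \<open>Injectivity on edges lets the image commute with removing the two edges.\<close>
  have im: "(`) f ` (edges T - {{x, a}, {y, b}}) =
      (`) f ` edges T - {{f x, f a}, {f y, f b}}"
    using e by (subst inj_on_image_set_diff[OF inj_on_edges[OF sg f]]) auto
  have "{f x, f a} \<in> (`) f ` edges T" "{f y, f b} \<in> (`) f ` edges T"
    using imageI[OF e(1), of "(`) f"] imageI[OF e(2), of "(`) f"] by simp_all
  moreover have "f x \<noteq> f y" using f V ne by (auto dest: inj_onD)
  ultimately have "swappable (edges (map_graph f T)) (f x) (f a) (f y) (f b)"
    using sw reach_map[of "edges T - {{x, a}, {y, b}}" x y f]
    by (simp add: swappable_def im)
  moreover have "map_graph f T' = \<lparr>verts = verts (map_graph f T),
      edges = swap_edges (edges (map_graph f T)) (f x) (f a) (f y) (f b)\<rparr>"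
    by (simp add: map_graph_def T' swap_edges_def image_Un im)
  moreover have "degree (map_graph f T) (f x) = degree (map_graph f T) (f y)"
    using deg degree_map_graph[OF sg f] V by simp
  ultimately show ?thesis
    using tree_map_graph[OF T f] unfolding swap_step_def by blast
qed

lemma swap_steps_invariants:
  assumes "swap_step\<^sup>*\<^sup>* T T'"
  shows "tree T \<Longrightarrow> tree T'" "verts T' = verts T" "SO T' = SO T" "optimal T \<Longrightarrow> optimal T'"
  using assms
  by (induction rule: rtranclp_induct) (auto dest: swap_step_invariants)

lemma swap_steps_sym: "swap_step\<^sup>*\<^sup>* T T' \<Longrightarrow> swap_step\<^sup>*\<^sup>* T' T"
  by (induction rule: rtranclp_induct)
    (auto intro: converse_rtranclp_into_rtranclp swap_step_sym)

lemma swap_steps_map_graph: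
  assumes "swap_step\<^sup>*\<^sup>* T T'" and f: "inj_on f (verts T)"
  shows "swap_step\<^sup>*\<^sup>* (map_graph f T) (map_graph f T')"
  using assms(1)
proof (induction rule: rtranclp_induct)
  case (step U W)
  then have "inj_on f (verts U)" using f swap_steps_invariants(2) by metis
  with step show ?case by (meson rtranclp.rtrancl_into_rtrancl swap_step_map_graph)
qed simp

section \<open>The greedy tree\<close>

lemma greedy_used_mono: "i \<le> j \<Longrightarrow> greedy_used D i \<le> greedy_used D j"
  by (rule lift_Suc_mono_le[of "greedy_used D"]) auto

lemma greedy_used_pos: "1 \<le> greedy_used D i"
  using greedy_used_mono[of 0 i D] by simp

text \<open>Consecutive half-open blocks of children; for \<open>i = 0\<close> truncated subtraction
  makes the block empty.\<close>

abbreviation greedy_interval :: "nat list \<Rightarrow> nat \<Rightarrow> nat set" where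
  "greedy_interval D i \<equiv> {greedy_used D (i - 1)<..greedy_used D i}"

lemma greedy_parent_unique:
  assumes "j \<in> greedy_interval D i" "j \<in> greedy_interval D i'"
  shows "i = i'"
proof (rule ccontr)
  assume "i \<noteq> i'"
  then have "i \<le> i' - 1 \<or> i' \<le> i - 1" by linarith
  then show False
    using assms greedy_used_mono[of i "i' - 1" D] greedy_used_mono[of i' "i - 1" D] by auto
qed

lemma greedy_parent_exists:
  "1 < j \<Longrightarrow> j \<le> greedy_used D k \<Longrightarrow> \<exists>i\<in>{1..k}. j \<in> greedy_interval D i"
proof (induction k)
  case (Suc k)
  show ?case
  proof (cases "j \<le> greedy_used D k")
    case True
    with Suc show ?thesis by fastforce
  next
    case False
    with Suc.prems show ?thesis by (intro bexI[of _ "Suc k"]) auto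
  qed
qed simp

text \<open>The first \<open>k\<close> vertices have the children prescribed by the greedy construction; the clause
  \<open>i < greedy_used D i\<close> says that vertex \<open>i + 1\<close> is already among the vertices used.\<close>

definition greedy_upto :: "nat list \<Rightarrow> nat \<Rightarrow> 'a sgraph \<Rightarrow> (nat \<Rightarrow> 'a) \<Rightarrow> bool" where
  "greedy_upto D k T w \<longleftrightarrow> sorted (rev D) \<and> bij_betw w {1..length D} (verts T) \<and>
     (\<forall>i\<in>{1..length D}. degree T (w i) = D ! (i - 1)) \<and>
     greedy_used D k \<le> length D \<and> (\<forall>i<k. i < greedy_used D i) \<and>
     (\<forall>i\<in>{1..k}. \<forall>j\<in>{1..length D}. i < j \<longrightarrow>
        ({w i, w j} \<in> edges T \<longleftrightarrow> j \<in> greedy_interval D i))"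

section \<open>One stage of the greedy construction\<close>

context
  fixes D :: "nat list" and k :: nat and T :: "'a sgraph" and w :: "nat \<Rightarrow> 'a"
  assumes T: "tree T" and upto: "greedy_upto D k T w" and k: "k < length D"
begin

lemma upto_bij: "bij_betw w {1..length D} (verts T)"
  and upto_degree: "\<And>i. i \<in> {1..length D} \<Longrightarrow> degree T (w i) = D ! (i - 1)"
  and upto_used: "greedy_used D k \<le> length D"
  and upto_gt: "\<And>i. i < k \<Longrightarrow> i < greedy_used D i"
  and upto_edge: "\<And>i j. i \<in> {1..k} \<Longrightarrow> j \<in> {1..length D} \<Longrightarrow> i < j \<Longrightarrow>
    {w i, w j} \<in> edges T \<longleftrightarrow> j \<in> greedy_interval D i"
  using upto by (auto simp: greedy_upto_def)

lemma upto_simple: "simple_graph T"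
  using T by (rule tree_simple)

lemma upto_eq_iff:
  "i \<in> {1..length D} \<Longrightarrow> j \<in> {1..length D} \<Longrightarrow> w i = w j \<longleftrightarrow> i = j"
  using upto_bij by (meson bij_betw_imp_inj_on inj_on_eq_iff)

lemma upto_verts: "z \<in> verts T \<longleftrightarrow> (\<exists>i\<in>{1..length D}. z = w i)"
  using upto_bij by (auto simp: bij_betw_def)

lemma upto_degree_mono:
  "i \<in> {1..length D} \<Longrightarrow> j \<in> {1..length D} \<Longrightarrow> i \<le> j \<Longrightarrow> degree T (w j) \<le> degree T (w i)"
  using upto by (auto simp: greedy_upto_def intro!: sorted_rev_nth_mono)

lemma upto_interval:
  assumes "i \<in> {1..k}" "j \<in> greedy_interval D i"
  shows "i < j" "j \<le> greedy_used D k" "j \<in> {1..length D}"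
proof -
  show le: "j \<le> greedy_used D k"
    using assms greedy_used_mono[of i k D] by simp
  have "i - 1 < k" "1 \<le> i" using assms(1) by auto
  then have "i - 1 < greedy_used D (i - 1)" "1 \<le> i" using upto_gt by blast+
  then show "i < j" using assms(2) unfolding greaterThanAtMost_iff by linarith
  then show "j \<in> {1..length D}" using le upto_used by simp
qed

definition placed :: "'a set set" where
  "placed = {{w i, w j} | i j. i \<in> {1..k} \<and> j \<in> greedy_interval D i}"

lemma placed_subset: "placed \<subseteq> edges T"
  using upto_edge upto_interval by (auto simp: placed_def)

text \<open>Every used vertex except the root has a parent of smaller index among the first
  \<open>k\<close>, so strong induction leads back to \<open>w 1\<close>.\<close>

lemma reach_placed:
  "j \<in> {1..greedy_used D k} \<Longrightarrow> reach placed (w 1) (w j)"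
proof (induction j rule: less_induct)
  case (less j)
  show ?case
  proof (cases "j = 1")
    case False
    then obtain i where i: "i \<in> {1..k}" "j \<in> greedy_interval D i"
      using less.prems greedy_parent_exists[of j D k] by auto
    then have "i < j" by (rule upto_interval)
    then have "reach placed (w 1) (w i)" using less i by auto
    moreover have "{w i, w j} \<in> placed" using i by (auto simp: placed_def)
    ultimately show ?thesis using reach_edge reach_trans by metis
  qed simp
qed

text \<open>Otherwise all used vertices would already have their children, so they would be closed
  under adjacency, although the tree is connected and has more than \<open>k\<close>
  vertices.\<close>

lemma less_greedy_used: "k < greedy_used D k"
proof (rule ccontr)
  assume "\<not> k < greedy_used D k"
  then have uk: "greedy_used D k \<le> k" by simp
  let ?V = "w ` {1..greedy_used D k}"
  have closed: "z \<in> ?V" if "reach (edges T) (w 1) z" for z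
    using that
  proof (induction rule: reach_induct)
    case base
    then show ?case using greedy_used_pos by (intro imageI) simp
  next
    case (step y z)
    then obtain i where i: "y = w i" "1 \<le> i" "i \<le> greedy_used D k" by auto
    have "z \<in> verts T" "y \<noteq> z" using simple_graph_edge[OF upto_simple step.hyps(2)] by auto
    then obtain j where j: "z = w j" "1 \<le> j" "j \<le> length D" using upto_verts by auto
    have "i \<noteq> j" using \<open>y \<noteq> z\<close> i j by auto
    have "j \<le> greedy_used D k"
    proof (cases "i < j")
      case True
      then have "j \<in> greedy_interval D i"
        using upto_edge[of i j] i j uk step.hyps(2) by auto
      then show ?thesis using upto_interval(2)[of i j] i uk by auto
    qed (use i in auto)
    with j show ?case by auto
  qed
  have "w 1 \<in> verts T" "w (length D) \<in> verts T" using upto_verts k by (auto intro!: bexI)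
  then have "w (length D) \<in> ?V" using T closed by (auto simp: tree_iff)
  then obtain i where "1 \<le> i" "i \<le> greedy_used D k" "w (length D) = w i" by auto
  then have "i = length D" using upto_eq_iff[of "length D" i] uk k by simp
  then show False using \<open>i \<le> greedy_used D k\<close> uk k by simp
qed

lemma placed_less:
  assumes "{w i, w j} \<in> placed" "i \<in> {1..length D}" "j \<in> {1..length D}"
  shows "i \<le> k \<or> j \<le> k"
proof -
  obtain i' j' where *: "{w i, w j} = {w i', w j'}" "i' \<in> {1..k}" "j' \<in> greedy_interval D i'"
    using assms(1) by (auto simp: placed_def)
  have "i' \<in> {1..length D}" using * k by auto
  then show ?thesis
    using * assms upto_eq_iff upto_interval(3)[of i' j'] by (auto simp: doubleton_eq_iff)
qed

text \<open>Placed edges connect all used vertices, and none of them joins two vertices of index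
  above \<open>k\<close>; a further edge between two such used vertices would close a cycle.\<close>

lemma no_edge_inside:
  assumes "k < i" "i < j" "j \<le> greedy_used D k"
  shows "{w i, w j} \<notin> edges T"
proof
  assume e: "{w i, w j} \<in> edges T"
  have "{w i, w j} \<notin> placed"
    using placed_less[of i j] assms upto_used by auto
  then have sub: "placed \<subseteq> edges T - {{w i, w j}}" using placed_subset by auto
  have "reach placed (w i) (w j)"
    using reach_placed[of i] reach_placed[of j] assms by (auto intro: reach_trans reach_sym)
  then have "reach (edges T - {{w i, w j}}) (w i) (w j)" using sub by (rule reach_mono)
  then show False using T e by (auto simp: tree_iff dest: forest_bridge)
qed

text \<open>The indices of the children that vertex \<open>Suc k\<close> actually has, to be
  compared with its prescribed block.\<close>

definition new_nbrs :: "nat set" where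
  "new_nbrs = {l \<in> {greedy_used D k<..length D}. {w (Suc k), w l} \<in> edges T}"

lemma card_new_nbrs: "card new_nbrs = greedy_children D (Suc k)"
proof -
  let ?x = "w (Suc k)"
  let ?N = "{l \<in> {1..length D}. {?x, w l} \<in> edges T}"
  have Sk: "Suc k \<in> {1..length D}" using k by simp
  have "{e \<in> edges T. ?x \<in> e} = (\<lambda>l. {?x, w l}) ` ?N"
  proof (intro equalityI subsetI)
    fix e assume "e \<in> {e \<in> edges T. ?x \<in> e}"
    then have "e \<in> edges T" "?x \<in> e" by simp_all
    moreover from this obtain c where "e = {?x, c}" using edge_other_end[OF upto_simple] by blast
    ultimately obtain c where c: "e = {?x, c}" "e \<in> edges T" by blast
    then have "c \<in> verts T" using simple_graph_edge[OF upto_simple] by blast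
    then show "e \<in> (\<lambda>l. {?x, w l}) ` ?N" using c upto_verts by auto
  qed auto
  moreover have "inj_on (\<lambda>l. {?x, w l}) ?N"
    using upto_eq_iff by (auto simp: inj_on_def doubleton_eq_iff)
  ultimately have deg: "D ! k = card ?N"
    using upto_degree[OF Sk] by (simp add: degree_def card_image)
  \<comment> \<open>\<open>?P\<close> holds the index of the parent: it is empty for the root and a
    singleton otherwise, which is the case distinction in \<open>greedy_children\<close>.\<close>
  let ?P = "{l \<in> {1..k}. Suc k \<in> greedy_interval D l}"
  have "?N = ?P \<union> new_nbrs"
  proof (intro equalityI subsetI)
    fix l assume l: "l \<in> ?N"
    show "l \<in> ?P \<union> new_nbrs"
    proof (cases "l \<le> k")
      case True
      then show ?thesis using l upto_edge[of l "Suc k"] k by (auto simp: insert_commute)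
    next
      case False
      have "l \<noteq> Suc k" using l simple_graph_edge[OF upto_simple, of ?x "w l"] by auto
      then have "greedy_used D k < l" using False l no_edge_inside[of "Suc k" l] by force
      then show ?thesis using l by (simp add: new_nbrs_def)
    qed
  next
    fix l assume "l \<in> ?P \<union> new_nbrs"
    then show "l \<in> ?N"
      using upto_edge[of l "Suc k"] k by (auto simp: new_nbrs_def insert_commute)
  qed
  moreover have "?P \<inter> new_nbrs = {}"
    using less_greedy_used by (auto simp: new_nbrs_def)
  ultimately have "D ! k = card ?P + card new_nbrs"
    unfolding deg by (simp add: card_Un_disjoint new_nbrs_def)
  moreover have "card ?P = (if k = 0 then 0 else 1)"
  proof (cases "k = 0")
    case False
    then obtain i where i: "i \<in> {1..k}" "Suc k \<in> greedy_interval D i"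
      using greedy_parent_exists[of "Suc k" D k] less_greedy_used by auto
    then have "?P = {i}" using greedy_parent_unique by blast
    then show ?thesis using False by simp
  qed simp
  ultimately show ?thesis by (auto simp: greedy_children_def)
qed

lemma greedy_used_Suc_le: "greedy_used D (Suc k) \<le> length D"
proof -
  have "new_nbrs \<subseteq> {greedy_used D k<..length D}" by (auto simp: new_nbrs_def)
  then have "card new_nbrs \<le> length D - greedy_used D k"
    using card_mono[of "{greedy_used D k<..length D}" new_nbrs] by simp
  then show ?thesis using card_new_nbrs upto_used by simp
qed

lemma greedy_upto_Suc:
  assumes "new_nbrs = greedy_interval D (Suc k)"
  shows "greedy_upto D (Suc k) T w"
proof -
  have "{w (Suc k), w j} \<in> edges T \<longleftrightarrow> j \<in> greedy_interval D (Suc k)"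
    if "Suc k < j" "j \<le> length D" for j
  proof (cases "j \<le> greedy_used D k")
    case True
    then show ?thesis using no_edge_inside[of "Suc k" j] that by simp
  next
    case False
    then show ?thesis using that unfolding assms[symmetric] by (simp add: new_nbrs_def)
  qed
  moreover have "i < greedy_used D i" if "i < Suc k" for i
    using that upto_gt less_greedy_used by (cases "i = k") auto
  ultimately show ?thesis
    using upto greedy_used_Suc_le upto_edge
    unfolding greedy_upto_def by (auto simp: le_Suc_eq)
qed

end

section \<open>Reaching the greedy tree\<close>

text \<open>A wrong child \<open>l\<close> of the current vertex is traded for a missing prescribed
  child \<open>j\<close>. For equal degrees renumbering suffices; otherwise \<open>w l\<close> is
  exchanged with \<open>w j\<close> at its parent, and minimality forces that parent to have the
  degree of the current vertex.\<close>

lemma greedy_improve: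
  assumes opt: "optimal T" and upto: "greedy_upto D k T w" and k: "k < length D"
    and j: "j \<in> greedy_interval D (Suc k)" "j \<notin> new_nbrs D k T w"
    and l: "l \<in> new_nbrs D k T w" "l \<notin> greedy_interval D (Suc k)"
  shows "\<exists>T' w'. swap_step\<^sup>*\<^sup>* T T' \<and> greedy_upto D k T' w' \<and>
    new_nbrs D k T' w' = insert j (new_nbrs D k T w - {l})"
proof -
  have T: "tree T" using opt by (simp add: optimal_def)
  note stage = T upto k
  note eq_iff = upto_eq_iff[OF stage]
  define x where "x = w (Suc k)"
  have kD: "Suc k \<in> {1..length D}" using k by simp
  have kj: "Suc k < j" "greedy_used D k < j" and jD: "j \<in> {1..length D}"
    using j(1) less_greedy_used[OF stage] greedy_used_Suc_le[OF stage] by auto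
  have lD: "l \<in> {1..length D}" and kl: "greedy_used D k < l" and xl: "{x, w l} \<in> edges T"
    using l(1) by (auto simp: new_nbrs_def[OF stage] x_def)
  have jl: "j < l" using j(1) l(2) kl by auto
  have old: "m \<notin> greedy_interval D i" if "i \<in> {1..k}" "greedy_used D k < m" for i m
    using that upto_interval(2)[OF stage, of i m] by linarith
  have old_edge: "{w i, w m} \<notin> edges T" if "i \<in> {1..k}" "m \<in> {j, l}" for i m
    using upto_edge[OF stage, of i m] old[of i m] that kj kl jD lD jl by auto
  show ?thesis
  proof (cases "degree T (w l) = degree T (w j)")
    case True
    define w' where "w' = w(j := w l, l := w j)"
    have w': "w' i = w i" if "i \<noteq> j" "i \<noteq> l" for i using that by (simp add: w'_def)
    have wjl: "w' j = w l" "w' l = w j" using jl by (simp_all add: w'_def)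
    have "inj_on w' {1..length D}"
      using eq_iff jD lD by (auto simp: inj_on_def w'_def)
    moreover have "w' ` {1..length D} = w ` {1..length D}"
    proof (intro equalityI subsetI)
      fix z assume "z \<in> w' ` {1..length D}"
      then show "z \<in> w ` {1..length D}" using jD lD by (auto simp: w'_def)
    next
      fix z assume "z \<in> w ` {1..length D}"
      then obtain i where i: "i \<in> {1..length D}" "z = w i" by blast
      consider "i = j" | "i = l" | "i \<noteq> j" "i \<noteq> l" by blast
      then show "z \<in> w' ` {1..length D}"
      proof cases
        case 1 with i wjl lD show ?thesis by (intro image_eqI[of _ _ l]) auto
      next
        case 2 with i wjl jD show ?thesis by (intro image_eqI[of _ _ j]) auto
      next
        case 3 with i w' show ?thesis by (intro image_eqI[of _ _ i]) auto
      qed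
    qed
    ultimately have "bij_betw w' {1..length D} (verts T)"
      using upto_bij[OF stage] by (simp add: bij_betw_def)
    moreover have "degree T (w' i) = D ! (i - 1)" if "i \<in> {1..length D}" for i
      using that upto_degree[OF stage] True jD lD by (auto simp: w'_def)
    moreover have "{w' i, w' m} \<in> edges T \<longleftrightarrow> m \<in> greedy_interval D i"
      if i: "i \<in> {1..k}" "i < m" and m: "m \<in> {1..length D}" for i m
    proof -
      have wi: "w' i = w i" using i kj jl by (intro w') auto
      show ?thesis
      proof (cases "m \<in> {j, l}")
        case True
        then have "{w' i, w' m} \<notin> edges T" using wi old_edge[of i] i wjl by auto
        moreover have "m \<notin> greedy_interval D i" using old[OF i(1), of m] True kj kl by blast
        ultimately show ?thesis by blast
      next
        case False
        then show ?thesis using w'[of m] wi upto_edge[OF stage i(1) m i(2)] by auto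
      qed
    qed
    ultimately have "greedy_upto D k T w'"
      using upto unfolding greedy_upto_def by blast
    moreover have "new_nbrs D k T w' = insert j (new_nbrs D k T w - {l})"
    proof -
      have wk: "w' (Suc k) = x" using kj jl by (simp add: w'_def x_def)
      have "{x, w j} \<notin> edges T" using j(2) jD kj by (simp add: new_nbrs_def[OF stage] x_def)
      then show ?thesis
        using xl jl kj kl jD lD wjl
        unfolding new_nbrs_def[OF stage] new_nbrs_def[OF T calculation k] wk x_def[symmetric]
        by (auto simp: w'_def split: if_splits)
    qed
    ultimately show ?thesis by blast
  next
    case False
    have lt: "degree T (w l) < degree T (w j)"
      using upto_degree_mono[OF stage jD lD] jl False by simp
    have sg: "simple_graph T" using T by (rule tree_simple)
    have bridge: "\<not> reach (edges T - {{x, w l}}) x (w l)"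
      using T xl by (auto simp: tree_iff dest: forest_bridge)
    have xj: "x \<noteq> w j" using eq_iff[OF kD jD] kj by (simp add: x_def)
    have xj_edge: "{x, w j} \<notin> edges T" using j(2) jD kj by (simp add: new_nbrs_def[OF stage] x_def)
    have sub: "placed D k w \<subseteq> edges T - {{x, w l}}"
      using placed_subset[OF stage] placed_less[OF stage, of "Suc k" l] kD lD kl
        less_greedy_used[OF stage] by (auto simp: x_def)
    have near: "reach (edges T - {{x, w l}}) x (w i)" if "i \<in> {1..k}" for i
    proof (rule reach_mono[OF _ sub])
      show "reach (placed D k w) x (w i)"
        unfolding x_def using that less_greedy_used[OF stage]
        by (intro reach_trans[OF reach_sym[OF reach_placed[OF stage]] reach_placed[OF stage]]) auto
    qed
    \<comment> \<open>Vertices beyond \<open>w l\<close> have index above \<open>k\<close>, because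
      placed edges connect the first \<open>k\<close> with \<open>x\<close>; the numbering then
      bounds their degrees as \<open>optimal_degree_beyond\<close> demands.\<close>
    have "degree T z \<le> degree T x" if z: "reach (edges T - {{x, w l}}) (w l) z" for z
    proof -
      have "reach (edges T) (w l) z" using z by (rule reach_mono) auto
      then have "z \<in> verts T"
        using reach_verts sg simple_graph_edge[OF sg xl] by metis
      then obtain i where i: "i \<in> {1..length D}" "z = w i"
        using upto_verts[OF stage] by blast
      have "\<not> i \<le> k"
      proof
        assume "i \<le> k"
        then have "reach (edges T - {{x, w l}}) x z" using near i by auto
        then show False using bridge reach_trans[OF _ reach_sym[OF z]] by blast
      qed
      then show ?thesis using upto_degree_mono[OF stage kD i(1)] i by (simp add: x_def)
    qed
    \<comment> \<open>Having larger degree than \<open>w l\<close>, the vertex \<open>w j\<close>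
      cannot lie beyond it; so the path from \<open>x\<close> to \<open>w j\<close> avoids
      \<open>{x, w l}\<close>, and \<open>p\<close> will be its last vertex before
      \<open>w j\<close>.\<close>
    then have "\<not> reach (edges T - {{x, w l}}) (w l) (w j)"
      using optimal_degree_beyond[OF opt xl] lt by force
    moreover have "x \<in> verts T" "w j \<in> verts T"
      using upto_verts[OF stage] kD jD unfolding x_def by blast+
    then have "reach (edges T) x (w j)" using T by (simp add: tree_iff)
    ultimately have "reach (edges T - {{x, w l}}) x (w j)"
      using reach_remove[of "edges T" x "w j" x "w l"] by blast
    then obtain p where p: "{p, w j} \<in> edges T - {{x, w l}}"
        "reach (edges T - {{x, w l}} - {{p, w j}}) x p"
      using reach_last_edge[OF _ xj] by blast
    have "edges T - {{x, w l}} - {{p, w j}} = edges T - {{x, w l}, {p, w j}}" by auto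
    then have sw: "swappable (edges T) x (w l) p (w j)"
      using p xl xj_edge unfolding swappable_def by auto
    have "p \<in> verts T" using p(1) simple_graph_edge[OF sg] by blast
    then obtain i where i: "i \<in> {1..length D}" "p = w i" using upto_verts[OF stage] by blast
    \<comment> \<open>\<open>p\<close> is not \<open>x\<close>, since \<open>w j\<close> is no
      neighbour of \<open>x\<close>, and not among the first \<open>k\<close>, whose children have
      indices at most \<open>greedy_used D k\<close>, hence below \<open>j\<close>.\<close>
    have ik: "Suc k < i"
    proof (rule ccontr)
      assume "\<not> Suc k < i"
      moreover have "i \<noteq> Suc k" using p(1) xj_edge i(2) by (auto simp: x_def)
      ultimately have "i \<in> {1..k}" using i(1) by auto
      then show False using old_edge[of i j] p(1) i(2) by auto
    qed
    \<comment> \<open>The numbering gives one inequality and minimality the other: a smaller degree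
      of \<open>p\<close> would make the exchange profitable.\<close>
    have "degree T p \<le> degree T x"
      using upto_degree_mono[OF stage kD i(1)] ik i(2) by (simp add: x_def)
    moreover have "\<not> degree T p < degree T x"
      using optimal_swappable[OF opt sw] lt by auto
    ultimately have deg: "degree T x = degree T p" by simp
    define T' where "T' = \<lparr>verts = verts T, edges = swap_edges (edges T) x (w l) p (w j)\<rparr>"
    have st: "swap_step T T'" using T deg sw unfolding swap_step_def T'_def by blast
    note inv = swap_step_invariants[OF st]
    have E': "edges T' = (edges T - {{x, w l}, {p, w j}}) \<union> {{x, w j}, {p, w l}}"
      by (simp add: T'_def swap_edges_def)
    \<comment> \<open>All endpoints of the exchanged edges have index above \<open>k\<close>, so no
      edge at the first \<open>k\<close> vertices changes.\<close>
    have "{w s, w m} \<in> edges T' \<longleftrightarrow> {w s, w m} \<in> edges T"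
      if "s \<in> {1..k}" "m \<in> {1..length D}" for s m
    proof -
      have "s \<in> {1..length D}" using that k by auto
      then have "w s \<noteq> x" "w s \<noteq> p" "w s \<noteq> w j" "w s \<noteq> w l"
        using eq_iff[of s] kD jD lD i ik that(1) kj jl by (auto simp: x_def)
      then show ?thesis unfolding E' by (auto simp: doubleton_eq_iff)
    qed
    then have "greedy_upto D k T' w"
      using upto inv(2,3) unfolding greedy_upto_def by simp
    moreover have "new_nbrs D k T' w = insert j (new_nbrs D k T w - {l})"
    proof -
      have px: "p \<noteq> x" using eq_iff[OF i(1) kD] ik i(2) by (simp add: x_def)
      have xw: "x \<noteq> w l" using simple_graph_edge[OF sg xl] by simp
      have "{x, w m} \<in> edges T' \<longleftrightarrow> m = j \<or> m \<noteq> l \<and> {x, w m} \<in> edges T"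
        if m: "m \<in> {1..length D}" for m
        using eq_iff[OF m jD] eq_iff[OF m lD] px xw xj jl
        unfolding E' by (auto simp: doubleton_eq_iff)
      then show ?thesis
        using jD kj
        unfolding new_nbrs_def[OF stage] new_nbrs_def[OF inv(1) calculation k] x_def[symmetric]
        by auto
    qed
    ultimately show ?thesis using st by blast
  qed
qed

text \<open>Induction on the number of prescribed children still missing, each improvement lowering
  it.\<close>

lemma greedy_extend:
  assumes "optimal T" "greedy_upto D k T w" "k < length D"
  shows "\<exists>T' w'. swap_step\<^sup>*\<^sup>* T T' \<and> greedy_upto D (Suc k) T' w'"
  using assms
proof (induction "card (greedy_interval D (Suc k) - new_nbrs D k T w)" arbitrary: T w
    rule: less_induct)
  case less
  let ?I = "greedy_interval D (Suc k)" and ?N = "new_nbrs D k T w"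
  have T: "tree T" using less.prems by (simp add: optimal_def)
  note stage = T less.prems(2,3)
  have finN: "finite ?N" by (simp add: new_nbrs_def[OF stage])
  have card: "card ?N = card ?I" using card_new_nbrs[OF stage] by simp
  show ?case
  proof (cases "?I \<subseteq> ?N")
    case True
    then have "?N = ?I" using card finN card_subset_eq by metis
    then show ?thesis using greedy_upto_Suc[OF stage] by blast
  next
    case False
    then obtain j where j: "j \<in> ?I" "j \<notin> ?N" by blast
    have "\<not> ?N \<subseteq> ?I"
    proof
      assume "?N \<subseteq> ?I"
      then have "?N = ?I" using card card_subset_eq[of ?I ?N] by simp
      then show False using False by simp
    qed
    then obtain l where l: "l \<in> ?N" "l \<notin> ?I" by blast
    obtain T1 w1 where 1: "swap_step\<^sup>*\<^sup>* T T1" "greedy_upto D k T1 w1"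
        "new_nbrs D k T1 w1 = insert j (?N - {l})"
      using greedy_improve[OF less.prems j l] by (elim exE conjE) (rule that)
    have "?I - new_nbrs D k T1 w1 \<subset> ?I - ?N" unfolding 1(3) using j l by blast
    then have "card (?I - new_nbrs D k T1 w1) < card (?I - ?N)"
      by (intro psubset_card_mono) simp_all
    moreover have "optimal T1" using swap_steps_invariants(4)[OF 1(1)] less.prems(1) by blast
    ultimately obtain T' w' where "swap_step\<^sup>*\<^sup>* T1 T'" "greedy_upto D (Suc k) T' w'"
      using less.hyps[of T1 w1] 1(2) less.prems(3) by blast
    with 1(1) show ?thesis by (meson rtranclp_trans)
  qed
qed

text \<open>Exchanges keep minimality, so the stages can be chained.\<close>

lemma greedy_reachable:
  assumes "optimal T" "greedy_upto D 0 T w" "k \<le> length D"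
  shows "\<exists>T' w'. swap_step\<^sup>*\<^sup>* T T' \<and> greedy_upto D k T' w'"
  using assms(3)
proof (induction k)
  case 0
  then show ?case using assms(2) by blast
next
  case (Suc k)
  then obtain T1 w1 where 1: "swap_step\<^sup>*\<^sup>* T T1" "greedy_upto D k T1 w1" by auto
  have "optimal T1" using swap_steps_invariants(4)[OF 1(1)] assms(1) by blast
  then obtain T' w' where "swap_step\<^sup>*\<^sup>* T1 T'" "greedy_upto D (Suc k) T' w'"
    using greedy_extend 1(2) Suc.prems by (metis Suc_le_eq)
  with 1(1) show ?case by (meson rtranclp_trans)
qed

section \<open>Initial numbering and completed construction\<close>

lemma greedy_upto_0:
  assumes T: "tree T"
  shows "\<exists>w. greedy_upto (degree_sequence T) 0 T w"
proof -
  have fin: "finite (verts T)" and ne: "verts T \<noteq> {}"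
    using T by (auto simp: tree_iff simple_graph_def)
  obtain ys where ys: "set ys = verts T" "distinct ys"
    using fin finite_distinct_list by blast
  \<comment> \<open>Sorting by degree and reversing gives the numbering; at \<open>k = 0\<close>
    only the conditions on the numbering and \<open>1 \<le> length D\<close> remain.\<close>
  define xs where "xs = rev (sort_key (degree T) ys)"
  define D where "D = degree_sequence T"
  have "mset_set (verts T) = mset ys" using ys by (metis mset_set_set)
  then have "D = rev (sort (map (degree T) ys))"
    by (simp add: D_def degree_sequence_def flip: mset_map)
  also have "sort (map (degree T) ys) = map (degree T) (sort_key (degree T) ys)"
    by (rule properties_for_sort) simp_all
  finally have D: "D = map (degree T) xs" by (simp add: xs_def rev_map)
  have xs: "set xs = verts T" "distinct xs" using ys by (simp_all add: xs_def)
  have len: "length D = length xs" by (simp add: D)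
  have "sorted (rev D)" by (simp add: D_def degree_sequence_def)
  moreover have "bij_betw (\<lambda>i. xs ! (i - 1)) {1..length D} (verts T)"
  proof -
    have "bij_betw (\<lambda>i. i - 1) {1..length D} {..<length xs}"
      by (rule bij_betw_byWitness[of _ Suc]) (auto simp: len)
    moreover have "bij_betw ((!) xs) {..<length xs} (verts T)"
      using xs by (auto intro: bij_betw_nth)
    ultimately show ?thesis by (auto dest: bij_betw_trans simp: comp_def)
  qed
  moreover have "1 \<le> length D" using ne xs len by (cases xs) auto
  ultimately have "greedy_upto D 0 T (\<lambda>i. xs ! (i - 1))"
    by (auto simp: greedy_upto_def D)
  then show ?thesis by (auto simp: D_def)
qed

text \<open>At the last stage the edge clause covers every pair of vertices and so determines the
  tree; the blocks then also stay within \<open>{1..length D}\<close>.\<close>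

lemma greedy_upto_length:
  assumes T: "tree T" and w: "greedy_upto D (length D) T w"
  shows "T = map_graph w (greedy_tree D)" "inj_on w (verts (greedy_tree D))"
    "simple_graph (greedy_tree D)"
proof -
  let ?n = "length D"
  have bij: "bij_betw w {1..?n} (verts T)" and un: "greedy_used D ?n \<le> ?n"
    and gt: "\<And>i. i < ?n \<Longrightarrow> i < greedy_used D i"
    and ed: "\<And>i j. i \<in> {1..?n} \<Longrightarrow> j \<in> {1..?n} \<Longrightarrow> i < j \<Longrightarrow>
      {w i, w j} \<in> edges T \<longleftrightarrow> j \<in> greedy_interval D i"
    using w by (auto simp: greedy_upto_def)
  have int: "i < j \<and> j \<in> {1..?n}" if "i \<in> {1..?n}" "j \<in> greedy_interval D i" for i j
  proof -
    have "i - 1 < ?n" "1 \<le> i" using that(1) by auto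
    then have "i - 1 < greedy_used D (i - 1)" "1 \<le> i" using gt by blast+
    then have "i < j" using that(2) unfolding greaterThanAtMost_iff by linarith
    moreover have "j \<le> ?n"
      using that greedy_used_mono[of i ?n D] un by auto
    ultimately show ?thesis by auto
  qed
  have "e \<subseteq> {1..?n} \<and> card e = 2" if e: "e \<in> edges (greedy_tree D)" for e
  proof -
    obtain i j where ij: "e = {i, j}" "i \<in> {1..?n}" "j \<in> greedy_interval D i"
      using e by (auto simp: greedy_tree_def)
    with int[OF ij(2,3)] show ?thesis by auto
  qed
  then show "simple_graph (greedy_tree D)"
    unfolding simple_graph_def by (simp add: greedy_tree_def)
  have sg: "simple_graph T" using T by (rule tree_simple)
  show "inj_on w (verts (greedy_tree D))" using bij by (simp add: greedy_tree_def bij_betw_def)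
  show "T = map_graph w (greedy_tree D)"
  proof (rule sgraph_eqI)
    show "verts T = verts (map_graph w (greedy_tree D))"
      using bij by (simp add: greedy_tree_def bij_betw_def)
    show "edges T = edges (map_graph w (greedy_tree D))"
    proof (intro equalityI subsetI)
      fix e assume e: "e \<in> edges T"
      then have "card e = 2" using sg by (simp add: simple_graph_def)
      then obtain s t where st: "e = {s, t}" by (auto simp: card_2_iff)
      then have "s \<in> w ` {1..?n}" "t \<in> w ` {1..?n}" "s \<noteq> t"
        using e simple_graph_edge[OF sg] bij by (auto simp: bij_betw_def)
      then obtain i j where ij: "i \<in> {1..?n}" "j \<in> {1..?n}" "s = w i" "t = w j" by blast
      then have "i \<noteq> j" using \<open>s \<noteq> t\<close> by blast
      \<comment> \<open>The edge clause speaks only of \<open>i < j\<close>, so the endpoints are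
        ordered by index.\<close>
      have "\<exists>i\<in>{1..?n}. \<exists>j\<in>{1..?n}. i < j \<and> e = {w i, w j}"
      proof (cases "i < j")
        case True
        then show ?thesis using ij st by blast
      next
        case False
        then have "j < i" using \<open>i \<noteq> j\<close> by simp
        moreover have "e = {w j, w i}" using ij st by auto
        ultimately show ?thesis using ij by blast
      qed
      then obtain i j where ij: "i \<in> {1..?n}" "j \<in> {1..?n}" "i < j" "e = {w i, w j}" by blast
      then have "j \<in> greedy_interval D i" using ed[OF ij(1-3)] ij(4) e by blast
      then have "{i, j} \<in> edges (greedy_tree D)"
        using ij(1) unfolding greedy_tree_def select_convs by blast
      moreover have "e = w ` {i, j}" using ij by simp
      ultimately show "e \<in> edges (map_graph w (greedy_tree D))"
        unfolding map_graph_sel by blast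
    next
      fix e assume "e \<in> edges (map_graph w (greedy_tree D))"
      then obtain i j where ij: "e = {w i, w j}" "i \<in> {1..?n}" "j \<in> greedy_interval D i"
        by (auto simp: greedy_tree_def)
      then show "e \<in> edges T" using ed[of i j] int[of i j] by auto
    qed
  qed
qed

text \<open>Exchanges keep the vertex set, so they end at a copy of the greedy tree on the vertices
  of \<open>T\<close>.\<close>

lemma optimal_greedy:
  assumes "optimal T"
  shows "simple_graph (greedy_tree (degree_sequence T)) \<and>
    (\<exists>w. inj_on w (verts (greedy_tree (degree_sequence T))) \<and>
    swap_step\<^sup>*\<^sup>* T (map_graph w (greedy_tree (degree_sequence T))))"
proof -
  have T: "tree T" using assms by (simp add: optimal_def)
  obtain w0 where "greedy_upto (degree_sequence T) 0 T w0" using greedy_upto_0[OF T] by blast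
  then obtain T' w where *: "swap_step\<^sup>*\<^sup>* T T'"
      "greedy_upto (degree_sequence T) (length (degree_sequence T)) T' w"
    using greedy_reachable[OF assms] by blast
  have "tree T'" using swap_steps_invariants(1)[OF *(1) T] .
  from greedy_upto_length[OF this *(2)] *(1) show ?thesis by blast
qed

section \<open>Characterization of the minimal trees\<close>

lemma inj_on_map_graph_inv:
  "inj_on f (verts G) \<Longrightarrow> inj_on (inv_into (verts G) f) (verts (map_graph f G))"
  by (simp add: inj_on_inv_into)

theorem theorem3p15:
  fixes D :: "nat list" and T\<^sub>0 :: "'b sgraph" and T :: "'a sgraph"
  assumes "tree T\<^sub>0" and "D = degree_sequence T\<^sub>0"
    and "T \<in> trees_with_degree_sequence D"
  shows "SO T = Min (SO ` (trees_with_degree_sequence D :: 'a sgraph set)) \<longleftrightarrow>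
    (\<exists>T'. branch_exchange\<^sup>*\<^sup>* (greedy_tree D) T' \<and> isomorphic T T')"
proof -
  let ?TD = "trees_with_degree_sequence D :: 'a sgraph set"
  let ?G = "greedy_tree D"
  have T: "tree T" and D: "degree_sequence T = D"
    using assms(3) by (auto simp: trees_with_degree_sequence_def)
  have fin: "finite (SO ` ?TD)" by (rule finite_SO_trees)
  have opt_iff: "optimal S \<longleftrightarrow> SO S = Min (SO ` ?TD)" if "S \<in> ?TD" for S :: "'a sgraph"
  proof -
    have "SO S = Min (SO ` ?TD) \<longleftrightarrow> (\<forall>U\<in>?TD. SO S \<le> SO U)"
      using that by (subst eq_Min_iff[OF fin]) auto
    then show ?thesis
      using that by (auto simp: optimal_def trees_with_degree_sequence_def)
  qed
  \<comment> \<open>A minimizer \<open>M\<close> leads by exchanges to a copy of \<open>?G\<close>;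
    this shows that \<open>?G\<close> is a tree and that its \<open>SO\<close> is the
    minimum.\<close>
  have "Min (SO ` ?TD) \<in> SO ` ?TD" using fin assms(3) by (intro Min_in) auto
  then obtain M where M: "M \<in> ?TD" "SO M = Min (SO ` ?TD)" by auto
  then have Mopt: "optimal M" and MD: "degree_sequence M = D" and Mtree: "tree M"
    using opt_iff by (auto simp: trees_with_degree_sequence_def)
  obtain w where sgG: "simple_graph ?G"
    and w: "inj_on w (verts ?G)" "swap_step\<^sup>*\<^sup>* M (map_graph w ?G)"
    using optimal_greedy[OF Mopt] MD by auto
  have treeG': "tree (map_graph w ?G)" using swap_steps_invariants(1)[OF w(2) Mtree] .
  have treeG: "tree ?G"
    using tree_map_graph[OF treeG' inj_on_map_graph_inv[OF w(1)]] map_graph_inv[OF sgG w(1)] by simp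
  have SOG: "SO ?G = Min (SO ` ?TD)"
    using SO_map_graph[OF sgG w(1)] swap_steps_invariants(3)[OF w(2)] M(2) by simp
  show ?thesis
  proof
    assume "SO T = Min (SO ` ?TD)"
    then have "optimal T" using opt_iff assms(3) by blast
    then obtain v where v: "inj_on v (verts ?G)" "swap_step\<^sup>*\<^sup>* T (map_graph v ?G)"
      using optimal_greedy D by blast
    \<comment> \<open>The exchanges from \<open>T\<close> to the copy of \<open>?G\<close> are
      reversed and transported along the inverse of \<open>v\<close>; they then start at
      \<open>?G\<close> itself and end at a copy of \<open>T\<close>.\<close>
    let ?g = "inv_into (verts ?G) v"
    have "verts T = verts (map_graph v ?G)" using swap_steps_invariants(2)[OF v(2)] by simp
    then have g: "inj_on ?g (verts T)" using inj_on_map_graph_inv[OF v(1)] by simp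
    have "swap_step\<^sup>*\<^sup>* (map_graph ?g (map_graph v ?G)) (map_graph ?g T)"
      using swap_steps_map_graph[OF swap_steps_sym[OF v(2)]] inj_on_map_graph_inv[OF v(1)] by blast
    then have "swap_step\<^sup>*\<^sup>* ?G (map_graph ?g T)"
      using map_graph_inv[OF sgG v(1)] by simp
    then have "branch_exchange\<^sup>*\<^sup>* ?G (map_graph ?g T)"
      by (rule mono_rtranclp[rule_format, rotated]) (rule swap_step_imp_branch_exchange)
    moreover have "isomorphic T (map_graph ?g T)"
      using tree_simple[OF T] g by (rule isomorphic_map_graph)
    ultimately show "\<exists>T'. branch_exchange\<^sup>*\<^sup>* ?G T' \<and> isomorphic T T'" by blast
  next
    assume "\<exists>T'. branch_exchange\<^sup>*\<^sup>* ?G T' \<and> isomorphic T T'"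
    then obtain T' where T': "branch_exchange\<^sup>*\<^sup>* ?G T'" "isomorphic T T'" by blast
    \<comment> \<open>Exchanges and isomorphisms both keep \<open>SO\<close>, so \<open>T\<close>
      has the value of \<open>?G\<close>.\<close>
    from T'(1) have "tree T' \<and> SO T' = SO ?G"
      by (induction rule: rtranclp_induct) (auto simp: treeG branch_exchange_SO branch_exchange_tree)
    moreover from this obtain f where "inj_on f (verts T)" "T' = map_graph f T"
      using isomorphic_imp_map_graph[OF T'(2) tree_simple[OF T]] tree_simple by blast
    ultimately show "SO T = Min (SO ` ?TD)"
      using SO_map_graph[OF tree_simple[OF T]] SOG by metis
  qed
qed

end
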